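(* Let $d\ge 1$ and let $f:\mathbb{P}^{1}\rightarrow\mathbb{G}(d,2d)$ be a rational curve (a morphism of complex algebraic varieties) such that $$\deg(f)=d,\qquad \Delta(f)\neq 0,\qquad \varpi(f)\leq 3.$$ Then $f$ is $\mathrm{GL}_{2d}(\mathbb{C})$-equivalent to the Morita curve $f_{M}:\mathbb{P}^{1}\rightarrow\mathbb{G}(d,2d)$, i.e. there exists $g\in \mathrm{GL}_{2d}(\mathbb{C})$ such that $f=g\circ f_{M}$.
   Context: Everything is over $\mathbb{C}$. $\mathbb{G}=\mathbb{G}(d,2d)$ is the Grassmannian of $d$-dimensional linear subspaces of $\mathbb{C}^{2d}$, with the natural action of $\mathrm{GL}_{2d}(\mathbb{C})$, and $\mathbb{P}^1=\mathbb{G}(1,2)$. On $\mathbb{G}$ there is the tautological exact sequence $0\to S\to \mathbb{C}^{2d}\otimes\mathcal{O}_{\mathbb{G}}\to Q\to 0$, where the fibre of $S$ at a point is the corresponding subspace of $\mathbb{C}^{2d}$. Morita curve: identify $\mathbb{C}^{2d}=\mathbb{C}^{d}\otimes_{\mathbb{C}}\mathbb{C}^{2}$; then $f_M$ sends a line $\ell\subset\mathbb{C}^2$ to the $d$-dimensional subspace $\mathbb{C}^d\otimes_{\mathbb{C}} \ell\subset\mathbb{C}^d\otimes_{\mathbb{C}}\mathbb{C}^2$. Degree: $\deg(f):=-\deg f^{*}\det S$ (the Plücker degree). $\Delta(f)$: one has $\Omega^1_{\mathbb{G}}= S\otimes Q^{\vee}$, so the differential $f^*\Omega^1_{\mathbb{G}}\to\Omega^1_{\mathbb{P}^1}$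 of $f$ is equivalent to an $\mathcal{O}_{\mathbb{P}^1}$-linear morphism $f^{*}S\to f^{*}Q\otimes\Omega^1_{\mathbb{P}^1}$ of locally free sheaves of rank $d$ (where $\Omega^1_{\mathbb{P}^1}\cong\mathcal{O}_{\mathbb{P}^1}(-2)$). $\Delta(f)$ denotes the determinant of this morphism, a global section of $(\det f^*S)^{-1}\otimes\det f^*Q\otimes(\Omega^1_{\mathbb{P}^1})^{\otimes d}\cong (f^*(\det S)(d))^{-2}$; $\Delta(f)\ne 0$ means that it is not the zero section. Width: by Grothendieck's theorem $f^{*}S\cong\bigoplus_{i=1}^{d}\mathcal{O}_{\mathbb{P}^{1}}(-a_{i})$ with integers $0\leq a_{1}\leq\dots\leq a_{d}$, and $\varpi(f):=a_{d}-a_{1}$. *)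

theory Defs
  imports "HOL-Analysis.Analysis"
begin

text \<open>
  Linear algebra over the complex numbers uses the constants of the interpretation \<open>vec\<close>
  (the unqualified \<open>span\<close>, \<open>subspace\<close>, \<open>dim\<close> of the library are the real ones).
  The type \<open>complex^('d \<times> 2)\<close> is \<open>C^d \<otimes> C^2 = C^(2d)\<close> with \<open>d = CARD('d)\<close>; the coordinates are
  those of the basis \<open>e_i \<otimes> e_k\<close>.
\<close>

definition grassmannian :: "nat \<Rightarrow> (complex^'n) set set" where
  "grassmannian k = {F. vec.subspace F \<and> vec.dim F = k}"

abbreviation P1 :: "(complex^2) set set" where
  "P1 \<equiv> grassmannian 1"

abbreviation line_through :: "complex^2 \<Rightarrow> (complex^2) set" where
  "line_through v \<equiv> vec.span {v}"

type_synonym 'd curve = "(complex^2) set \<Rightarrow> (complex^('d \<times> 2)) set"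


subsection \<open>Regular functions and sheaves on the projective line\<close>

definition binary_form :: "nat \<Rightarrow> (complex^2 \<Rightarrow> complex) \<Rightarrow> bool" where
  "binary_form n P \<longleftrightarrow> (\<exists>c. \<forall>v. P v = (\<Sum>k\<le>n. c k * (v$1)^k * (v$2)^(n - k)))"

definition zariski_open :: "(complex^2) set set \<Rightarrow> bool" where
  "zariski_open U \<longleftrightarrow>
     (\<exists>T. (\<forall>P\<in>T. \<exists>n. binary_form n P) \<and> U = {l \<in> P1. \<exists>P\<in>T. \<exists>v\<in>l. P v \<noteq> 0})"

definition punctured_cone :: "(complex^2) set set \<Rightarrow> (complex^2) set" where
  "punctured_cone U = {v. v \<noteq> 0 \<and> line_through v \<in> U}"

text \<open>
  A section of \<open>O(n)\<close> over \<open>U\<close> is a function on the punctured cone over \<open>U\<close> which is locally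
  \<open>P / Q\<close> with forms \<open>P\<close>, \<open>Q\<close> and \<open>deg P - deg Q = n\<close>. To make equality of sections the equality
  of functions, sections take the value 0 outside the cone. For \<open>n = 0\<close> this is the structure
  sheaf.
\<close>

definition twisting_sheaf :: "int \<Rightarrow> (complex^2) set set \<Rightarrow> (complex^2 \<Rightarrow> complex) set" where
  "twisting_sheaf n U =
     {h. (\<forall>v. v \<notin> punctured_cone U \<longrightarrow> h v = 0) \<and>
         (\<forall>l\<in>U. \<exists>V. zariski_open V \<and> l \<in> V \<and> V \<subseteq> U \<and>
            (\<exists>a b P Q. binary_form a P \<and> binary_form b Q \<and> int a - int b = n \<and>
               (\<forall>v\<in>punctured_cone V. Q v \<noteq> 0 \<and> h v = P v / Q v)))}"

type_synonym 'm sheaf = "(complex^2) set set \<Rightarrow> (complex^2 \<Rightarrow> complex^'m) set"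

definition twist_sum :: "('m::finite \<Rightarrow> int) \<Rightarrow> 'm sheaf" where
  "twist_sum n U = {s. \<forall>i. (\<lambda>v. s v $ i) \<in> twisting_sheaf (n i) U}"

text \<open>
  For a subbundle of a trivial bundle, given by its fibres \<open>E l\<close>: its sheaf of regular sections.
\<close>

definition subbundle_sheaf :: "((complex^2) set \<Rightarrow> (complex^'m::finite) set) \<Rightarrow> 'm sheaf" where
  "subbundle_sheaf E U =
     {s \<in> twist_sum (\<lambda>_. 0) U. \<forall>v\<in>punctured_cone U. s v \<in> E (line_through v)}"

definition restrict_section ::
    "(complex^2) set set \<Rightarrow> (complex^2 \<Rightarrow> complex^'m) \<Rightarrow> (complex^2 \<Rightarrow> complex^'m)" where
  "restrict_section V s = (\<lambda>v. if v \<in> punctured_cone V then s v else 0)"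

text \<open>Isomorphism of sheaves of modules over the structure sheaf.\<close>

definition sheaf_iso :: "'m::finite sheaf \<Rightarrow> 'k::finite sheaf \<Rightarrow> bool" where
  "sheaf_iso F G \<longleftrightarrow>
     (\<exists>\<phi>. \<forall>U. zariski_open U \<longrightarrow>
        bij_betw (\<phi> U) (F U) (G U) \<and>
        (\<forall>s\<in>F U. \<forall>t\<in>F U. \<phi> U (\<lambda>v. s v + t v) = (\<lambda>v. \<phi> U s v + \<phi> U t v)) \<and>
        (\<forall>h\<in>twisting_sheaf 0 U. \<forall>s\<in>F U. \<phi> U (\<lambda>v. h v *s s v) = (\<lambda>v. h v *s \<phi> U s v)) \<and>
        (\<forall>V. zariski_open V \<and> V \<subseteq> U \<longrightarrow>
           (\<forall>s\<in>F U. \<phi> V (restrict_section V s) = restrict_section V (\<phi> U s))))"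

definition line_bundle_degree :: "'m::finite sheaf \<Rightarrow> int" where
  "line_bundle_degree L = (THE n. sheaf_iso L (twist_sum (\<lambda>_::1. n)))"


subsection \<open>Morphisms to the Grassmannian\<close>

text \<open>
  The standard affine charts of \<open>G(d,2d)\<close>: for an injective choice \<open>I\<close> of \<open>d\<close> of the \<open>2d\<close>
  coordinates, the matrices \<open>N\<close> whose rows \<open>I\<close> form the identity matrix parametrize, by their
  column spaces, an open affine space; the remaining entries of \<open>N\<close> are the affine coordinates.
  A map is a morphism if locally its image lies in a chart and its coordinates are regular.
\<close>

definition chart_matrix :: "('d::finite \<Rightarrow> 'd \<times> 2) \<Rightarrow> complex^'d^('d \<times> 2) \<Rightarrow> bool" where
  "chart_matrix I N \<longleftrightarrow> (\<forall>i j. N $ (I i) $ j = (if i = j then 1 else 0))"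

definition is_morphism :: "'d::finite curve \<Rightarrow> bool" where
  "is_morphism f \<longleftrightarrow>
     (\<forall>l\<in>P1. f l \<in> grassmannian CARD('d)) \<and>
     (\<forall>l\<in>P1. \<exists>U I N. zariski_open U \<and> l \<in> U \<and> inj I \<and>
        (\<forall>p j. (\<lambda>v. N v $ p $ j) \<in> twisting_sheaf 0 U) \<and>
        (\<forall>v\<in>punctured_cone U. chart_matrix I (N v) \<and> f (line_through v) = range ((*v) (N v))))"

definition tensor :: "complex^'d \<Rightarrow> complex^2 \<Rightarrow> complex^('d::finite \<times> 2)" where
  "tensor x v = (\<chi> p. x $ fst p * v $ snd p)"

definition morita_curve :: "'d::finite curve" where
  "morita_curve l = vec.span {tensor x v | x v. v \<in> l}"


subsection \<open>Degree and width\<close>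

text \<open>
  \<open>wedge w\<close> is \<open>w_1 \<and> \<dots> \<and> w_d\<close>, with the exterior power realized as the alternating tensors in
  the \<open>d\<close>-fold tensor power; its coordinates are the maximal minors.
\<close>

definition wedge :: "('d::finite \<Rightarrow> complex^'n::finite) \<Rightarrow> complex^('d \<Rightarrow> 'n)" where
  "wedge w = (\<chi> I. det (\<chi> i j. w j $ I i))"

definition top_exterior_power :: "(complex^('d::finite \<times> 2)) set \<Rightarrow> (complex^('d \<Rightarrow> 'd \<times> 2)) set" where
  "top_exterior_power F = vec.span {wedge w | w. \<forall>j. w j \<in> F}"

abbreviation pullback_S :: "'d::finite curve \<Rightarrow> ('d \<times> 2) sheaf" where
  "pullback_S f \<equiv> subbundle_sheaf f"

abbreviation pullback_det_S :: "'d::finite curve \<Rightarrow> ('d \<Rightarrow> 'd \<times> 2) sheaf" where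
  "pullback_det_S f \<equiv> subbundle_sheaf (\<lambda>l. top_exterior_power (f l))"

definition curve_degree :: "'d::finite curve \<Rightarrow> int" where
  "curve_degree f = - line_bundle_degree (pullback_det_S f)"

definition splitting_type :: "'d::finite curve \<Rightarrow> ('d \<Rightarrow> int) \<Rightarrow> bool" where
  "splitting_type f a \<longleftrightarrow> (\<forall>i. 0 \<le> a i) \<and> sheaf_iso (pullback_S f) (twist_sum (\<lambda>i. - a i))"

definition width :: "'d::finite curve \<Rightarrow> int" where
  "width f = (THE w. \<exists>a. splitting_type f a \<and> w = Max (range a) - Min (range a))"


subsection \<open>The determinant of the differential\<close>

text \<open>
  \<open>\<Omega>\<^sup>1\<close> is identified with \<open>O(-2)\<close> by means of the form \<open>v_1 dv_2 - v_2 dv_1\<close>. For \<open>h\<close>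
  homogeneous of degree 0, Euler's relation \<open>v_1 \<partial>_1 h + v_2 \<partial>_2 h = 0\<close> gives
  \<open>dh = ext_deriv h v \<cdot> (v_1 dv_2 - v_2 dv_1)\<close>.
\<close>

definition ext_deriv :: "(complex^2 \<Rightarrow> complex) \<Rightarrow> complex^2 \<Rightarrow> complex" where
  "ext_deriv h v =
     (if v$1 \<noteq> 0 then deriv (\<lambda>z. h (vector [v$1, z])) (v$2) / v$1
      else - deriv (\<lambda>z. h (vector [z, v$2])) (v$1) / v$2)"

definition quotient_class :: "(complex^'n) set \<Rightarrow> complex^'n \<Rightarrow> (complex^'n) set" where
  "quotient_class F u = (\<lambda>w. u + w) ` F"

text \<open>
  The morphism from \<open>f\<^sup>*S\<close> to \<open>f\<^sup>*Q \<otimes> \<Omega>\<^sup>1\<close> corresponding to the differential of \<open>f\<close>: a local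
  section \<open>s\<close> of \<open>f\<^sup>*S\<close>, seen as a vector valued function, goes to the class of \<open>ds\<close> modulo
  \<open>f\<^sup>*S\<close>. The fibre of \<open>f\<^sup>*Q\<close> at a line \<open>l\<close> is the set of cosets of \<open>f l\<close>.
\<close>

definition differential ::
    "'d::finite curve \<Rightarrow> (complex^2 \<Rightarrow> complex^('d \<times> 2)) \<Rightarrow> complex^2 \<Rightarrow> (complex^('d \<times> 2)) set" where
  "differential f s v =
     quotient_class (f (line_through v)) (\<chi> p. ext_deriv (\<lambda>u. s u $ p) v)"

definition frame_S ::
    "'d::finite curve \<Rightarrow> (complex^2) set set \<Rightarrow> ('d \<Rightarrow> complex^2 \<Rightarrow> complex^('d \<times> 2)) \<Rightarrow> bool" where
  "frame_S f U s \<longleftrightarrow>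
     (\<forall>j. s j \<in> pullback_S f U) \<and>
     (\<forall>v\<in>punctured_cone U. \<forall>u\<in>f (line_through v).
        \<exists>!c::complex^'d. u = (\<Sum>j\<in>UNIV. c $ j *s s j v))"

text \<open>A local frame of \<open>f\<^sup>*Q\<close>, given by lifts of its members to vector valued functions.\<close>

definition frame_Q ::
    "'d::finite curve \<Rightarrow> (complex^2) set set \<Rightarrow> ('d \<Rightarrow> complex^2 \<Rightarrow> complex^('d \<times> 2)) \<Rightarrow> bool" where
  "frame_Q f U q \<longleftrightarrow>
     (\<forall>i. q i \<in> twist_sum (\<lambda>_. 0) U) \<and>
     (\<forall>v\<in>punctured_cone U. \<forall>u. \<exists>!c::complex^'d.
        quotient_class (f (line_through v)) u =
        quotient_class (f (line_through v)) (\<Sum>i\<in>UNIV. c $ i *s q i v))"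

text \<open>
  The expression of \<open>\<Delta>(f)\<close> in local frames \<open>s\<close> of \<open>f\<^sup>*S\<close> and \<open>q\<close> of \<open>f\<^sup>*Q\<close>: the determinant of
  the matrix of the differential (a section of \<open>O(-2d)\<close>).
\<close>

definition Delta ::
    "'d::finite curve \<Rightarrow> ('d \<Rightarrow> complex^2 \<Rightarrow> complex^('d \<times> 2)) \<Rightarrow>
     ('d \<Rightarrow> complex^2 \<Rightarrow> complex^('d \<times> 2)) \<Rightarrow> complex^2 \<Rightarrow> complex" where
  "Delta f s q v =
     det (THE A :: complex^'d^'d. \<forall>j. differential f (s j) v =
            quotient_class (f (line_through v)) (\<Sum>i\<in>UNIV. A $ i $ j *s q i v))"

definition Delta_is_zero :: "'d::finite curve \<Rightarrow> bool" where
  "Delta_is_zero f \<longleftrightarrow>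
     (\<forall>U s q. zariski_open U \<and> frame_S f U s \<and> frame_Q f U q \<longrightarrow>
        (\<forall>v\<in>punctured_cone U. Delta f s q v = 0))"

end

theory Submission
  imports Defs "HOL-Complex_Analysis.Complex_Singularities"
begin

text \<open>
  Among the \<open>d\<close>-tuples of vector valued forms which take values in the fibres of \<open>f\<^sup>*S\<close> and are
  independent somewhere, take one of minimal total degree. It is independent at every point, since a
  relation at a point would allow to divide a combination by the equation of the point
  (\<open>form_frame_reduce\<close>). So it is a splitting of \<open>f\<^sup>*S\<close> into line bundles \<open>O(-a_j)\<close>
  (\<open>splitting_frame_exists\<close>), with the tuple as the columns of a matrix \<open>S(v)\<close>. Its maximal minors
  generate \<open>f\<^sup>*det S\<close>, and the degree of a line bundle on \<open>P^1\<close> is well defined by Liouville's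
  theorem; hence the sum of the \<open>a_j\<close> is the degree \<open>d\<close> (\<open>curve_degree_frame\<close>).

  Let \<open>v\<close> be a point where \<open>\<Delta>(f)\<close> does not vanish. Then a section whose derivative at \<open>v\<close> lies
  in the fibre over \<open>v\<close> vanishes at \<open>v\<close> (\<open>Delta_nonzero_injective\<close>). This excludes constant
  sections, so all \<open>a_j\<close> are positive; as there are \<open>d\<close> of them with sum \<open>d\<close>, they are all 1.
  Therefore \<open>S(w) x\<close> is bilinear, that is \<open>S(w) x = g (x \<otimes> w)\<close> for a square matrix \<open>g\<close>, and
  the fibre of \<open>f\<close> over the line of \<open>w\<close> is the image under \<open>g\<close> of that of the Morita curve.

  It remains to see that \<open>g\<close> is injective. Complete \<open>v\<close> to a basis \<open>v, e\<close> of \<open>C^2\<close>. If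
  \<open>g (x \<otimes> v + y \<otimes> e) = 0\<close>, then the section \<open>S(w) y\<close> has at \<open>v\<close>, in the direction \<open>e\<close>, the
  derivative \<open>S(e) y = - S(v) x\<close>, which lies in the fibre over \<open>v\<close>. Hence \<open>S(v) y = 0\<close>, so \<open>y = 0\<close>
  and then \<open>x = 0\<close>.
\<close>

no_notation fps_nth (infixl \<open>$\<close> 75)

section \<open>Binary forms\<close>

lemma binary_formE:
  assumes "binary_form n P"
  obtains c where "P = (\<lambda>v :: complex^2. \<Sum>k\<le>n. c k * (v$1)^k * (v$2)^(n - k))"
  using assms unfolding binary_form_def fun_eq_iff by blast

lemma binary_form_zero: "binary_form n (\<lambda>v. 0)"
  unfolding binary_form_def by (intro exI[of _ "\<lambda>_. 0"]) simp

lemma binary_form_const: "binary_form 0 (\<lambda>v. c)"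
  unfolding binary_form_def by (intro exI[of _ "\<lambda>_. c"]) simp

lemma binary_form_degree_0:
  assumes "binary_form 0 P"
  shows "P u = P v"
  using assms unfolding binary_form_def by auto

lemma binary_form_linear: "binary_form 1 (\<lambda>v. \<alpha> * v$1 + \<beta> * v$2)"
  unfolding binary_form_def
  by (intro exI[of _ "\<lambda>k. if k = 1 then \<alpha> else \<beta>"]) simp

lemma binary_form_add:
  assumes "binary_form n P" "binary_form n Q"
  shows "binary_form n (\<lambda>v. P v + Q v)"
proof -
  obtain c e where "\<forall>v. P v = (\<Sum>k\<le>n. c k * (v$1)^k * (v$2)^(n - k))"
    and "\<forall>v. Q v = (\<Sum>k\<le>n. e k * (v$1)^k * (v$2)^(n - k))"
    using assms unfolding binary_form_def by blast
  then show ?thesis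
    unfolding binary_form_def
    by (intro exI[of _ "\<lambda>k. c k + e k"]) (simp add: algebra_simps sum.distrib)
qed

lemma binary_form_sum:
  assumes "\<And>i. i \<in> A \<Longrightarrow> binary_form n (P i)"
  shows "binary_form n (\<lambda>v. \<Sum>i\<in>A. P i v)"
  using assms
  by (induction A rule: infinite_finite_induct) (simp_all add: binary_form_zero binary_form_add)

lemma binary_form_monomial:
  assumes "k \<le> n"
  shows "binary_form n (\<lambda>v. c * (v$1)^k * (v$2)^(n - k))"
  unfolding binary_form_def
proof (intro exI[of _ "\<lambda>i. if i = k then c else 0"] allI)
  fix v :: "complex^2"
  have "(\<Sum>i\<le>n. (if i = k then c else 0) * (v$1)^i * (v$2)^(n - i))
      = (\<Sum>i\<le>n. if i = k then c * (v$1)^k * (v$2)^(n - k) else 0)"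
    by (intro sum.cong) auto
  then show "c * (v$1)^k * (v$2)^(n - k) = (\<Sum>i\<le>n. (if i = k then c else 0) * (v$1)^i * (v$2)^(n - i))"
    using assms by simp
qed

lemma binary_form_mult:
  assumes "binary_form m P" "binary_form n Q"
  shows "binary_form (m + n) (\<lambda>v. P v * Q v)"
proof -
  obtain c where c: "P = (\<lambda>v. \<Sum>k\<le>m. c k * (v$1)^k * (v$2)^(m - k))"
    using assms(1) by (rule binary_formE)
  obtain e where e: "Q = (\<lambda>v. \<Sum>k\<le>n. e k * (v$1)^k * (v$2)^(n - k))"
    using assms(2) by (rule binary_formE)
  have "binary_form (m + n)
      (\<lambda>v. \<Sum>i\<le>m. \<Sum>j\<le>n. (c i * e j) * (v$1)^(i + j) * (v$2)^(m + n - (i + j)))"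
    by (intro binary_form_sum binary_form_monomial) auto
  also have "(\<lambda>v :: complex^2. \<Sum>i\<le>m. \<Sum>j\<le>n. (c i * e j) * (v$1)^(i + j) * (v$2)^(m + n - (i + j)))
      = (\<lambda>v. P v * Q v)"
    unfolding c e sum_product
  proof (intro ext sum.cong refl)
    fix v :: "complex^2" and i j
    assume "i \<in> {..m}" "j \<in> {..n}"
    then have "m + n - (i + j) = (m - i) + (n - j)" by auto
    then show "(c i * e j) * (v$1)^(i + j) * (v$2)^(m + n - (i + j))
        = c i * (v$1)^i * (v$2)^(m - i) * (e j * (v$1)^j * (v$2)^(n - j))"
      by (simp add: power_add)
  qed
  finally show ?thesis .
qed

lemma binary_form_cmult:
  assumes "binary_form n P"
  shows "binary_form n (\<lambda>v. c * P v)"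
  using binary_form_mult[OF binary_form_const assms] by simp

lemma binary_form_prod:
  assumes "\<And>i. i \<in> A \<Longrightarrow> binary_form (n i) (P i)"
  shows "binary_form (\<Sum>i\<in>A. n i) (\<lambda>v. \<Prod>i\<in>A. P i v)"
  using assms
  by (induction A rule: infinite_finite_induct) (simp_all add: binary_form_const binary_form_mult)

lemma binary_form_power:
  assumes "binary_form n P"
  shows "binary_form (k * n) (\<lambda>v. P v ^ k)"
  using binary_form_prod[of "{..<k}" "\<lambda>_. n" "\<lambda>_. P"] assms by simp

lemma binary_form_homogeneous:
  assumes "binary_form n P"
  shows "P (c *s v) = c ^ n * P v"
proof -
  obtain e where e: "\<And>v. P v = (\<Sum>k\<le>n. e k * (v$1)^k * (v$2)^(n - k))"
    using assms unfolding binary_form_def by blast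
  have "e k * (c * v$1)^k * (c * v$2)^(n - k) = c ^ n * (e k * (v$1)^k * (v$2)^(n - k))"
    if "k \<le> n" for k
  proof -
    have "c ^ n = c ^ k * c ^ (n - k)"
      using that by (simp flip: power_add)
    then show ?thesis by (simp add: power_mult_distrib)
  qed
  then have "(\<Sum>k\<le>n. e k * (c * v$1)^k * (c * v$2)^(n - k))
      = (\<Sum>k\<le>n. c ^ n * (e k * (v$1)^k * (v$2)^(n - k)))"
    by (intro sum.cong) auto
  then show ?thesis by (simp only: e sum_distrib_left vector_smult_component)
qed

lemma binary_form_substitution:
  assumes "binary_form n P"
  shows "binary_form n (\<lambda>v. P ((\<alpha> * v$1 + \<beta> * v$2) *s x + (\<gamma> * v$1 + \<delta> * v$2) *s y))"
proof -
  obtain e where e: "P = (\<lambda>v. \<Sum>k\<le>n. e k * (v$1)^k * (v$2)^(n - k))"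
    using assms by (rule binary_formE)
  have lin: "binary_form 1 (\<lambda>v. ((\<alpha> * v$1 + \<beta> * v$2) *s x + (\<gamma> * v$1 + \<delta> * v$2) *s y) $ i)" for i
    using binary_form_linear[of "\<alpha> * x$i + \<gamma> * y$i" "\<beta> * x$i + \<delta> * y$i"]
    by (simp add: algebra_simps)
  have "binary_form n (\<lambda>v. e k * (((\<alpha> * v$1 + \<beta> * v$2) *s x + (\<gamma> * v$1 + \<delta> * v$2) *s y) $ 1)^k *
      (((\<alpha> * v$1 + \<beta> * v$2) *s x + (\<gamma> * v$1 + \<delta> * v$2) *s y) $ 2)^(n - k))"
    if "k \<le> n" for k
    using binary_form_mult[OF binary_form_cmult[OF binary_form_power[OF lin[of 1], of k], of "e k"]
        binary_form_power[OF lin[of 2], of "n - k"]] that by simp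
  then show ?thesis unfolding e by (intro binary_form_sum) auto
qed

lemma complex2_coordinates:
  fixes x y :: "complex^2"
  assumes "x$1 * y$2 - x$2 * y$1 = D" "D \<noteq> 0"
  shows "((y$2 / D) * v$1 + (- y$1 / D) * v$2) *s x + ((- x$2 / D) * v$1 + (x$1 / D) * v$2) *s y = v"
proof -
  have *: "(y$2 * v$1 - y$1 * v$2) * x$i + (x$1 * v$2 - x$2 * v$1) * y$i = D * v$i" for i
    unfolding assms(1)[symmetric] using exhaust_2[of i] by (auto simp: algebra_simps)
  have "((y$2 / D) * v$1 + (- y$1 / D) * v$2) * x$i + ((- x$2 / D) * v$1 + (x$1 / D) * v$2) * y$i = v$i" for i
  proof -
    have "((y$2 / D) * v$1 + (- y$1 / D) * v$2) * x$i + ((- x$2 / D) * v$1 + (x$1 / D) * v$2) * y$i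
        = ((y$2 * v$1 - y$1 * v$2) * x$i + (x$1 * v$2 - x$2 * v$1) * y$i) / D"
      by (simp add: add_divide_distrib diff_divide_distrib left_diff_distrib)
    then show ?thesis using * assms(2) by simp
  qed
  then show ?thesis
    unfolding vec_eq_iff by (simp only: vector_add_component vector_smult_component simp_thms)
qed

lemma complement_vector:
  fixes x :: "complex^2"
  assumes "x \<noteq> 0"
  obtains y :: "complex^2" where "x$1 * y$2 - x$2 * y$1 \<noteq> 0"
proof (cases "x$1 = 0")
  case True
  then have "x$2 \<noteq> 0" using assms by (auto simp: vec_eq_iff forall_2)
  then show thesis using that[of "vector [1, 0]"] by simp
next
  case False
  then show thesis using that[of "vector [0, 1]"] by simp
qed

text \<open>
  The coordinates \<open>(a, b)\<close> with \<open>v = a x + b y\<close> turn vanishing at \<open>x\<close> into the vanishing of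
  the coefficient of \<open>a^n\<close>, and the remaining monomials are divisible by \<open>b\<close>.
\<close>

lemma binary_form_divide:
  fixes x :: "complex^2"
  assumes "binary_form (Suc n) P" "x \<noteq> 0" "P x = 0"
  obtains R where "binary_form n R" "\<And>v :: complex^2. P v = (x$1 * v$2 - x$2 * v$1) * R v"
proof -
  obtain y :: "complex^2" where "x$1 * y$2 - x$2 * y$1 \<noteq> 0"
    using complement_vector[OF assms(2)] .
  then obtain D where D: "x$1 * y$2 - x$2 * y$1 = D" "D \<noteq> 0" by blast
  define a b where "a = (\<lambda>v :: complex^2. (y$2 / D) * v$1 + (- y$1 / D) * v$2)"
    and "b = (\<lambda>v :: complex^2. (- x$2 / D) * v$1 + (x$1 / D) * v$2)"
  have ab: "a v *s x + b v *s y = v" for v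
    unfolding a_def b_def by (rule complex2_coordinates[OF D])
  have "binary_form (Suc n) (\<lambda>w. P (w$1 *s x + w$2 *s y))"
    using binary_form_substitution[OF assms(1), of 1 0 x 0 1 y] by simp
  then obtain c where c: "\<And>w :: complex^2. P (w$1 *s x + w$2 *s y)
      = (\<Sum>k\<le>Suc n. c k * (w$1)^k * (w$2)^(Suc n - k))"
    unfolding binary_form_def by blast
  have "c (Suc n) = 0"
  proof -
    have "P x = (\<Sum>k\<le>Suc n. c k * 1^k * 0^(Suc n - k))"
      using c[of "vector [1, 0]"] by simp
    also have "\<dots> = (\<Sum>k\<le>n. c k * 1^k * 0^(Suc n - k)) + c (Suc n)"
      by simp
    also have "(\<Sum>k\<le>n. c k * 1^k * 0^(Suc n - k)) = 0"
      by (intro sum.neutral) auto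
    finally show ?thesis using assms(3) by simp
  qed
  define R where "R = (\<lambda>v. (\<Sum>k\<le>n. c k * (a v)^k * (b v)^(n - k)) / D)"
  have lin: "binary_form 1 a" "binary_form 1 b"
    unfolding a_def b_def by (rule binary_form_linear)+
  have "binary_form n (\<lambda>v. c k * (a v)^k * (b v)^(n - k))" if "k \<le> n" for k
    using binary_form_mult[OF binary_form_cmult[OF binary_form_power[OF lin(1), of k], of "c k"]
        binary_form_power[OF lin(2), of "n - k"]] that by simp
  then have "binary_form n (\<lambda>v. \<Sum>k\<le>n. c k * (a v)^k * (b v)^(n - k))"
    by (intro binary_form_sum) auto
  then have "binary_form n R"
    unfolding R_def using binary_form_cmult[of n _ "1 / D"] by simp
  moreover have "P v = (x$1 * v$2 - x$2 * v$1) * R v" for v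
  proof -
    have "P v = (\<Sum>k\<le>Suc n. c k * (a v)^k * (b v)^(Suc n - k))"
      using c[of "vector [a v, b v]"] ab[of v] by simp
    also have "\<dots> = (\<Sum>k\<le>n. c k * (a v)^k * (b v)^(Suc n - k))"
      using \<open>c (Suc n) = 0\<close> by simp
    also have "\<dots> = (\<Sum>k\<le>n. b v * (c k * (a v)^k * (b v)^(n - k)))"
      by (intro sum.cong) (auto simp: Suc_diff_le)
    also have "\<dots> = b v * (\<Sum>k\<le>n. c k * (a v)^k * (b v)^(n - k))"
      by (rule sum_distrib_left[symmetric])
    also have "(\<Sum>k\<le>n. c k * (a v)^k * (b v)^(n - k)) = D * R v"
      using D(2) by (simp add: R_def)
    also have "b v * (D * R v) = b v * D * R v"
      by simp
    also have "b v * D = x$1 * v$2 - x$2 * v$1"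
      using D(2) by (simp add: b_def field_simps)
    finally show ?thesis .
  qed
  ultimately show thesis using that by blast
qed

lemma linear_form_nonvanishing:
  fixes x :: "complex^2"
  assumes "x \<noteq> 0"
  obtains L where "binary_form 1 L" "L x \<noteq> 0"
proof -
  obtain y :: "complex^2" where "x$1 * y$2 - x$2 * y$1 \<noteq> 0"
    using complement_vector[OF assms] .
  then show thesis
    using that[OF binary_form_linear[of "y$2" "- y$1"]] by (simp add: algebra_simps)
qed

lemma binary_form_isCont:
  assumes "binary_form n P"
  shows "isCont P v"
proof -
  obtain e where "P = (\<lambda>v. \<Sum>k\<le>n. e k * (v$1)^k * (v$2)^(n - k))"
    using assms by (rule binary_formE)
  then show ?thesis by (auto intro!: continuous_intros)
qed

lemma binary_form_differentiable:
  assumes "binary_form n P"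
  shows "(\<lambda>t. P (v + t *s w)) field_differentiable at t"
proof -
  obtain e where "P = (\<lambda>v. \<Sum>k\<le>n. e k * (v$1)^k * (v$2)^(n - k))"
    using assms by (rule binary_formE)
  then have *: "(\<lambda>t. P (v + t *s w))
      = (\<lambda>t. \<Sum>k\<le>n. e k * (v$1 + t * w$1)^k * (v$2 + t * w$2)^(n - k))"
    by simp
  have "(\<lambda>t. P (v + t *s w)) holomorphic_on UNIV"
    unfolding * by (intro holomorphic_intros)
  then show ?thesis by (simp add: holomorphic_on_def)
qed

text \<open>On the line from \<open>v\<close> to \<open>w\<close> a form is an entire function of \<open>t\<close>, so its zeros are isolated.\<close>

lemma binary_form_eventually_nonzero:
  assumes "binary_form n P" "P w \<noteq> 0"
  shows "\<forall>\<^sub>F t in at (0::complex). P (v + t *s (w - v)) \<noteq> 0"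
proof -
  have "(\<lambda>t. P (v + t *s (w - v))) holomorphic_on UNIV"
    unfolding holomorphic_on_def using binary_form_differentiable[OF assms(1)] by blast
  moreover have "P (v + 1 *s (w - v)) \<noteq> 0"
    using assms(2) by simp
  ultimately show ?thesis
    using non_zero_neighbour_alt[of "\<lambda>t. P (v + t *s (w - v))" UNIV 0 1] by (simp add: connected_UNIV)
qed


section \<open>Regular sections\<close>

lemma mem_line_through: "u \<in> line_through v \<longleftrightarrow> (\<exists>c. u = c *s v)"
  by (auto simp: vec.span_singleton)

lemma line_through_in_P1:
  assumes "v \<noteq> 0"
  shows "line_through v \<in> P1"
  using assms by (simp add: grassmannian_def vec.subspace_span vec.dim_span)

lemma P1_cases:
  assumes "l \<in> P1"
  obtains v where "v \<noteq> 0" "l = line_through v"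
proof -
  have l: "vec.subspace l" "vec.dim l = 1"
    using assms by (auto simp: grassmannian_def)
  obtain B where B: "B \<subseteq> l" "vec.independent B" "vec.span B = l" "card B = vec.dim l"
    using vec.basis_subspace_exists[OF l(1)] by metis
  then obtain v where "B = {v}"
    using l(2) by (metis card_1_singletonE)
  then show thesis
    using that[of v] B(2,3) vec.dependent_zero by blast
qed

lemma zariski_open_subset_P1: "zariski_open U \<Longrightarrow> U \<subseteq> P1"
  by (auto simp: zariski_open_def)

lemma punctured_cone_nonzero: "v \<in> punctured_cone U \<Longrightarrow> v \<noteq> 0"
  by (simp add: punctured_cone_def)

lemma zariski_open_basic:
  assumes "binary_form n P"
  shows "zariski_open {l \<in> P1. \<exists>v\<in>l. P v \<noteq> 0}"
  unfolding zariski_open_def using assms by (intro exI[of _ "{P}"]) auto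

lemma form_on_line:
  assumes "binary_form n P" "u \<in> line_through v" "P u \<noteq> 0"
  shows "P v \<noteq> 0"
  using assms binary_form_homogeneous[OF assms(1)] by (auto simp: mem_line_through)

lemma punctured_cone_basic:
  assumes "binary_form n P"
  shows "punctured_cone {l \<in> P1. \<exists>v\<in>l. P v \<noteq> 0} = {v. v \<noteq> 0 \<and> P v \<noteq> 0}"
proof -
  have "(\<exists>u\<in>line_through v. P u \<noteq> 0) \<longleftrightarrow> P v \<noteq> 0" for v
  proof
    show "P v \<noteq> 0" if "\<exists>u\<in>line_through v. P u \<noteq> 0"
      using form_on_line[OF assms] that by blast
    show "\<exists>u\<in>line_through v. P u \<noteq> 0" if "P v \<noteq> 0"
      using that vec.span_base[of v "{v}"] by (intro bexI[of _ v]) auto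
  qed
  then show ?thesis
    using line_through_in_P1 by (simp add: punctured_cone_def set_eq_iff del: One_nat_def) blast
qed

lemma zariski_open_nhd:
  assumes "zariski_open U" "v \<in> punctured_cone U"
  obtains n P where "binary_form n P" "P v \<noteq> 0"
    "\<And>u. u \<noteq> 0 \<Longrightarrow> P u \<noteq> 0 \<Longrightarrow> u \<in> punctured_cone U"
proof -
  obtain T where T: "\<And>P. P \<in> T \<Longrightarrow> \<exists>n. binary_form n P"
    and U: "U = {l \<in> P1. \<exists>P\<in>T. \<exists>v\<in>l. P v \<noteq> 0}"
    using assms(1) unfolding zariski_open_def by blast
  obtain P u where P: "P \<in> T" "u \<in> line_through v" "P u \<noteq> 0"
    using assms(2) by (auto simp: punctured_cone_def U)
  then obtain n where n: "binary_form n P" using T by blast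
  have "P v \<noteq> 0" using form_on_line[OF n P(2,3)] .
  moreover have "u \<in> punctured_cone U" if "u \<noteq> 0" "P u \<noteq> 0" for u
  proof -
    have "u \<in> line_through u" by (simp add: vec.span_base)
    then have "\<exists>P\<in>T. \<exists>w\<in>line_through u. P w \<noteq> 0"
      using that(2) P(1) by (intro bexI[of _ P] bexI[of _ u])
    then show ?thesis
      using that(1) line_through_in_P1 by (simp add: punctured_cone_def U)
  qed
  ultimately show thesis using that n by blast
qed

lemma eventually_form_nonzero:
  assumes "binary_form n P" "P v \<noteq> 0"
  shows "\<forall>\<^sub>F u in nhds v. P u \<noteq> 0"
proof -
  have "isCont P v" by (rule binary_form_isCont[OF assms(1)])
  then have "(P \<longlongrightarrow> P v) (nhds v)"
    by (simp add: continuous_at tendsto_at_iff_tendsto_nhds)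
  then show ?thesis
    using assms(2) tendsto_imp_eventually_ne by blast
qed

lemma eventually_nonzero:
  fixes v :: "complex^2"
  assumes "v \<noteq> 0" shows "\<forall>\<^sub>F u in nhds v. u \<noteq> 0"
  using assms t1_space_nhds by blast

lemma eventually_punctured_cone:
  assumes "zariski_open U" "v \<in> punctured_cone U"
  shows "\<forall>\<^sub>F u in nhds v. u \<in> punctured_cone U"
proof -
  obtain n P where P: "binary_form n P" "P v \<noteq> 0"
    "\<And>u. u \<noteq> 0 \<Longrightarrow> P u \<noteq> 0 \<Longrightarrow> u \<in> punctured_cone U"
    using zariski_open_nhd[OF assms] by metis
  show ?thesis
    using eventually_form_nonzero[OF P(1,2)] eventually_nonzero[OF punctured_cone_nonzero[OF assms(2)]]
    by eventually_elim (rule P(3))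
qed

text \<open>
  Shrinking to a basic open set and extending the fraction makes the denominator itself
  cut out the neighbourhood on which the representation is valid.
\<close>

lemma twisting_sheaf_fraction:
  assumes "h \<in> twisting_sheaf n U" "v \<in> punctured_cone U"
  obtains a b P R where "binary_form a P" "binary_form b R" "int a - int b = n" "R v \<noteq> 0"
    "\<And>u. u \<noteq> 0 \<Longrightarrow> R u \<noteq> 0 \<Longrightarrow> u \<in> punctured_cone U \<and> h u = P u / R u"
proof -
  obtain V a b P Q where V: "zariski_open V" "line_through v \<in> V" "V \<subseteq> U"
    and PQ: "binary_form a P" "binary_form b Q" "int a - int b = n"
    and h: "\<And>u. u \<in> punctured_cone V \<Longrightarrow> Q u \<noteq> 0 \<and> h u = P u / Q u"
  proof -
    have "line_through v \<in> U" using assms(2) by (simp add: punctured_cone_def)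
    then show thesis
      using assms(1) that unfolding twisting_sheaf_def mem_Collect_eq by meson
  qed
  have v: "v \<in> punctured_cone V"
    using V(2) assms(2) by (simp add: punctured_cone_def)
  obtain m T where T: "binary_form m T" "T v \<noteq> 0"
    "\<And>u. u \<noteq> 0 \<Longrightarrow> T u \<noteq> 0 \<Longrightarrow> u \<in> punctured_cone V"
    using zariski_open_nhd[OF V(1) v] by metis
  have "u \<in> punctured_cone U \<and> h u = (P u * T u) / (Q u * T u)"
    if "u \<noteq> 0" "Q u * T u \<noteq> 0" for u
    using T(3)[of u] h[of u] V(3) that by (auto simp: punctured_cone_def)
  moreover have "Q v * T v \<noteq> 0" using h[OF v] T(2) by simp
  ultimately show thesis
    using that[OF binary_form_mult[OF PQ(1) T(1)] binary_form_mult[OF PQ(2) T(1)]] PQ(3) by simp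
qed

text \<open>
  The local condition on sections of \<open>O(n)\<close>; the fraction is valid wherever its denominator is
  not zero, which replaces the open set in the definition of the sheaf.
\<close>

definition fraction_at ::
    "int \<Rightarrow> (complex^2) set set \<Rightarrow> (complex^2 \<Rightarrow> complex) \<Rightarrow> complex^2 \<Rightarrow> bool" where
  "fraction_at n U h v \<longleftrightarrow> (\<exists>a b P R. binary_form a P \<and> binary_form b R \<and> int a - int b = n \<and>
     R v \<noteq> 0 \<and> (\<forall>u. u \<in> punctured_cone U \<longrightarrow> R u \<noteq> 0 \<longrightarrow> h u = P u / R u))"

lemma fraction_atI:
  assumes "binary_form a P" "binary_form b R" "int a - int b = n" "R v \<noteq> 0"
    "\<And>u. u \<in> punctured_cone U \<Longrightarrow> R u \<noteq> 0 \<Longrightarrow> h u = P u / R u"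
  shows "fraction_at n U h v"
  using assms unfolding fraction_at_def by blast

lemma twisting_sheafI:
  assumes "zariski_open U" "\<And>v. v \<notin> punctured_cone U \<Longrightarrow> h v = 0"
    and loc: "\<And>v. v \<in> punctured_cone U \<Longrightarrow> fraction_at n U h v"
  shows "h \<in> twisting_sheaf n U"
proof -
  have "\<exists>V. zariski_open V \<and> l \<in> V \<and> V \<subseteq> U \<and>
            (\<exists>a b P Q. binary_form a P \<and> binary_form b Q \<and> int a - int b = n \<and>
               (\<forall>v\<in>punctured_cone V. Q v \<noteq> 0 \<and> h v = P v / Q v))" if "l \<in> U" for l
  proof -
    obtain v where v: "v \<noteq> 0" "l = line_through v"
      using \<open>l \<in> U\<close> zariski_open_subset_P1[OF assms(1)] P1_cases by (metis subsetD)
    then have vU: "v \<in> punctured_cone U"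
      using \<open>l \<in> U\<close> by (simp add: punctured_cone_def)
    obtain a b P R where PR: "binary_form a P" "binary_form b R" "int a - int b = n" "R v \<noteq> 0"
      and h: "\<And>u. u \<in> punctured_cone U \<Longrightarrow> R u \<noteq> 0 \<Longrightarrow> h u = P u / R u"
      using loc[OF vU] unfolding fraction_at_def by blast
    obtain m T where T: "binary_form m T" "T v \<noteq> 0"
      "\<And>u. u \<noteq> 0 \<Longrightarrow> T u \<noteq> 0 \<Longrightarrow> u \<in> punctured_cone U"
      using zariski_open_nhd[OF assms(1) vU] by metis
    have RT: "binary_form (b + m) (\<lambda>v. R v * T v)"
      by (rule binary_form_mult[OF PR(2) T(1)])
    let ?V = "{l \<in> P1. \<exists>v\<in>l. R v * T v \<noteq> 0}"
    have cone: "punctured_cone ?V = {v. v \<noteq> 0 \<and> R v * T v \<noteq> 0}"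
      by (rule punctured_cone_basic[OF RT])
    have "l' \<in> U" if l': "l' \<in> ?V" for l'
    proof -
      obtain u where u: "u \<noteq> 0" "l' = line_through u" using l' P1_cases by blast
      then have "u \<in> punctured_cone ?V" using l' by (simp add: punctured_cone_def)
      then have "u \<in> punctured_cone U" using T(3) u(1) cone by auto
      then show ?thesis by (simp add: u(2) punctured_cone_def)
    qed
    moreover have "l \<in> ?V"
      using v PR(4) T(2) line_through_in_P1[of v] vec.span_base[of v "{v}"] by auto
    moreover have "\<forall>v\<in>punctured_cone ?V. R v \<noteq> 0 \<and> h v = P v / R v"
      unfolding cone using T(3) h by auto
    ultimately show ?thesis
      using zariski_open_basic[OF RT] PR(1-3) by blast
  qed
  then show ?thesis using assms(2) by (simp add: twisting_sheaf_def)
qed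

lemma twisting_sheaf_outside: "h \<in> twisting_sheaf n U \<Longrightarrow> v \<notin> punctured_cone U \<Longrightarrow> h v = 0"
  by (simp add: twisting_sheaf_def)

lemma twisting_sheaf_form:
  assumes "zariski_open U" "binary_form a P"
  shows "(\<lambda>v. if v \<in> punctured_cone U then P v else 0) \<in> twisting_sheaf (int a) U"
  by (rule twisting_sheafI[OF assms(1)])
     (auto intro!: fraction_atI[OF assms(2) binary_form_const[of 1]])

lemma twisting_sheaf_mult:
  assumes "zariski_open U" "h \<in> twisting_sheaf m U" "k \<in> twisting_sheaf n U"
  shows "(\<lambda>v. h v * k v) \<in> twisting_sheaf (m + n) U"
proof (rule twisting_sheafI[OF assms(1)])
  fix v assume v: "v \<in> punctured_cone U"
  obtain a b P R where PR: "binary_form a P" "binary_form b R" "int a - int b = m" "R v \<noteq> 0"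
    "\<And>u. u \<noteq> 0 \<Longrightarrow> R u \<noteq> 0 \<Longrightarrow> u \<in> punctured_cone U \<and> h u = P u / R u"
    using twisting_sheaf_fraction[OF assms(2) v] by metis
  obtain a' b' P' R' where PR': "binary_form a' P'" "binary_form b' R'" "int a' - int b' = n" "R' v \<noteq> 0"
    "\<And>u. u \<noteq> 0 \<Longrightarrow> R' u \<noteq> 0 \<Longrightarrow> u \<in> punctured_cone U \<and> k u = P' u / R' u"
    using twisting_sheaf_fraction[OF assms(3) v] by metis
  show "fraction_at (m + n) U (\<lambda>v. h v * k v) v"
    by (rule fraction_atI[OF binary_form_mult[OF PR(1) PR'(1)] binary_form_mult[OF PR(2) PR'(2)]])
       (use PR(3,4,5) PR'(3,4,5) in \<open>auto dest: punctured_cone_nonzero\<close>)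
qed (simp add: twisting_sheaf_outside[OF assms(2)])

lemma twisting_sheaf_inverse:
  assumes "zariski_open U" "h \<in> twisting_sheaf n U" "\<And>v. v \<in> punctured_cone U \<Longrightarrow> h v \<noteq> 0"
  shows "(\<lambda>v. inverse (h v)) \<in> twisting_sheaf (- n) U"
proof (rule twisting_sheafI[OF assms(1)])
  fix v assume v: "v \<in> punctured_cone U"
  obtain a b P R where PR: "binary_form a P" "binary_form b R" "int a - int b = n" "R v \<noteq> 0"
    and h: "\<And>u. u \<noteq> 0 \<Longrightarrow> R u \<noteq> 0 \<Longrightarrow> u \<in> punctured_cone U \<and> h u = P u / R u"
    using twisting_sheaf_fraction[OF assms(2) v] by metis
  have "P v \<noteq> 0"
    using h[OF punctured_cone_nonzero[OF v] PR(4)] assms(3)[OF v] by auto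
  have "inverse (h u) = (R u * R u) / (P u * R u)" if "u \<in> punctured_cone U" "P u * R u \<noteq> 0" for u
    using h[of u] punctured_cone_nonzero[OF that(1)] that(2) by simp
  then show "fraction_at (- n) U (\<lambda>v. inverse (h v)) v"
    by (intro fraction_atI[OF binary_form_mult[OF PR(2) PR(2)] binary_form_mult[OF PR(1) PR(2)]])
       (use PR(3,4) \<open>P v \<noteq> 0\<close> in auto)
qed (simp add: twisting_sheaf_outside[OF assms(2)])

lemma twisting_sheaf_homogeneous:
  assumes "h \<in> twisting_sheaf n U" "v \<in> punctured_cone U" "c \<noteq> 0"
  shows "h (c *s v) = c powi n * h v"
proof -
  obtain a b P R where PR: "binary_form a P" "binary_form b R" "int a - int b = n" "R v \<noteq> 0"
    and h: "\<And>u. u \<noteq> 0 \<Longrightarrow> R u \<noteq> 0 \<Longrightarrow> u \<in> punctured_cone U \<and> h u = P u / R u"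
    using twisting_sheaf_fraction[OF assms(1,2)] by metis
  have "v \<noteq> 0" using assms(2) by (rule punctured_cone_nonzero)
  have "h (c *s v) = P (c *s v) / R (c *s v)"
    using h[of "c *s v"] \<open>v \<noteq> 0\<close> assms(3) PR(4) by (simp add: binary_form_homogeneous[OF PR(2)])
  also have "\<dots> = c ^ a / c ^ b * (P v / R v)"
    by (simp add: binary_form_homogeneous[OF PR(1)] binary_form_homogeneous[OF PR(2)])
  also have "c ^ a / c ^ b = c powi n"
    using assms(3) PR(3)[symmetric] by (simp add: power_int_diff)
  finally show ?thesis using h[OF \<open>v \<noteq> 0\<close> PR(4)] by simp
qed

lemma twisting_sheaf_isCont:
  assumes "h \<in> twisting_sheaf n U" "v \<in> punctured_cone U"
  shows "isCont h v"
proof -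
  obtain a b P R where PR: "binary_form a P" "binary_form b R" "R v \<noteq> 0"
    and h: "\<And>u. u \<noteq> 0 \<Longrightarrow> R u \<noteq> 0 \<Longrightarrow> u \<in> punctured_cone U \<and> h u = P u / R u"
    using twisting_sheaf_fraction[OF assms] by metis
  have "\<forall>\<^sub>F u in nhds v. h u = P u / R u"
    using eventually_form_nonzero[OF PR(2,3)] eventually_nonzero[OF punctured_cone_nonzero[OF assms(2)]]
    by eventually_elim (simp add: h)
  moreover have "isCont (\<lambda>u. P u / R u) v"
    using PR by (intro continuous_intros binary_form_isCont)
  ultimately show ?thesis by (simp add: isCont_cong)
qed

lemma twisting_sheaf_differentiable:
  assumes "h \<in> twisting_sheaf n U" "v + t *s w \<in> punctured_cone U"
  shows "(\<lambda>t. h (v + t *s w)) field_differentiable at t"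
proof -
  obtain a b P R where PR: "binary_form a P" "binary_form b R" "R (v + t *s w) \<noteq> 0"
    and h: "\<And>u. u \<noteq> 0 \<Longrightarrow> R u \<noteq> 0 \<Longrightarrow> u \<in> punctured_cone U \<and> h u = P u / R u"
    using twisting_sheaf_fraction[OF assms] by metis
  have "\<forall>\<^sub>F u in nhds (v + t *s w). h u = P u / R u"
    using eventually_form_nonzero[OF PR(2,3)] eventually_nonzero[OF punctured_cone_nonzero[OF assms(2)]]
    by eventually_elim (simp add: h)
  moreover have "filterlim (\<lambda>s. v + s *s w) (nhds (v + t *s w)) (nhds t)"
    by (rule vec_tendstoI) (auto intro!: tendsto_intros filterlim_ident)
  ultimately have ev: "\<forall>\<^sub>F s in nhds t. h (v + s *s w) = P (v + s *s w) / R (v + s *s w)"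
    by (rule eventually_compose_filterlim)
  have "(\<lambda>s. P (v + s *s w) / R (v + s *s w)) field_differentiable at t"
    using PR by (intro field_differentiable_divide binary_form_differentiable[OF PR(1)]
      binary_form_differentiable[OF PR(2)])
  then show ?thesis
    using ev DERIV_cong_ev[OF refl ev refl] unfolding field_differentiable_def by blast
qed


section \<open>Frames of forms\<close>

lemma fibre_subspace:
  assumes "is_morphism f" "v \<noteq> 0"
  shows "vec.subspace (f (line_through v))"
  using assms line_through_in_P1[OF assms(2)] by (auto simp: is_morphism_def grassmannian_def)

lemma morphism_chart:
  fixes f :: "'d::finite curve"
  assumes "is_morphism f" "v \<noteq> 0"
  obtains U and I :: "'d \<Rightarrow> 'd \<times> 2" and N :: "complex^2 \<Rightarrow> complex^'d^('d \<times> 2)" where "zariski_open U" "v \<in> punctured_cone U" "inj I"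
    "\<And>p j. (\<lambda>u. N u $ p $ j) \<in> twisting_sheaf 0 U"
    "\<And>u. u \<in> punctured_cone U \<Longrightarrow> f (line_through u) = range ((*v) (N u))"
    "\<And>u c i. u \<in> punctured_cone U \<Longrightarrow> (N u *v c) $ I i = c $ i"
proof -
  have "line_through v \<in> P1" using assms(2) by (rule line_through_in_P1)
  then obtain U I N where U: "zariski_open U" "line_through v \<in> U" "inj I"
    and N: "\<And>p j. (\<lambda>u. N u $ p $ j) \<in> twisting_sheaf 0 U"
    and f: "\<And>u. u \<in> punctured_cone U \<Longrightarrow> chart_matrix I (N u) \<and> f (line_through u) = range ((*v) (N u))"
    using assms(1) unfolding is_morphism_def by meson
  have "(N u *v c) $ I i = c $ i" if "u \<in> punctured_cone U" for u c i
    using f[OF that] by (simp add: chart_matrix_def matrix_vector_mult_def if_distribR if_distrib[of "\<lambda>x. x * _"] cong: if_cong)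
  then show thesis
    using that[of U I N] U N f assms(2) by (simp add: punctured_cone_def)
qed

lemma tendsto_matrix_vector_mult:
  fixes M :: "'b \<Rightarrow> complex^'n^'m::finite"
  assumes "\<And>p j. ((\<lambda>t. M t $ p $ j) \<longlongrightarrow> A $ p $ j) F" "\<And>j. ((\<lambda>t. x t $ j) \<longlongrightarrow> y $ j) F"
  shows "((\<lambda>t. M t *v x t) \<longlongrightarrow> A *v y) F"
  by (rule vec_tendstoI) (auto simp: matrix_vector_mult_def intro!: tendsto_intros assms)

lemma twisting_sheaf_tendsto:
  assumes "h \<in> twisting_sheaf n U" "v \<in> punctured_cone U" "(u \<longlongrightarrow> v) F"
  shows "((\<lambda>t. h (u t)) \<longlongrightarrow> h v) F"
  using isCont_tendsto_compose[OF twisting_sheaf_isCont[OF assms(1,2)] assms(3)] .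

text \<open>In a chart, membership in the fibre over \<open>u\<close> is the closed condition \<open>y = N(u) y_I\<close>.\<close>

lemma fibre_closed:
  fixes f :: "'d::finite curve"
  assumes "is_morphism f" "v \<noteq> 0" "F \<noteq> bot" and u: "(u \<longlongrightarrow> v) F" and x: "(x \<longlongrightarrow> y) F"
    and mem: "\<forall>\<^sub>F t in F. x t \<in> f (line_through (u t))"
  shows "y \<in> f (line_through v)"
proof -
  obtain U and I :: "'d \<Rightarrow> 'd \<times> 2" and N where U: "zariski_open U" "v \<in> punctured_cone U" "inj I"
    and N: "\<And>p j. (\<lambda>u. N u $ p $ j) \<in> twisting_sheaf 0 U"
    and f: "\<And>u. u \<in> punctured_cone U \<Longrightarrow> f (line_through u) = range ((*v) (N u))"
    and I: "\<And>u c i. u \<in> punctured_cone U \<Longrightarrow> (N u *v c) $ I i = c $ i"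
    by (rule morphism_chart[OF assms(1,2)]) (rule that)
  let ?r = "\<lambda>y :: complex^('d \<times> 2). (\<chi> i. y $ I i) :: complex^'d"
  have "\<forall>\<^sub>F t in F. u t \<in> punctured_cone U"
    using eventually_compose_filterlim[OF eventually_punctured_cone[OF U(1,2)] u] .
  with mem have eq: "\<forall>\<^sub>F t in F. N (u t) *v ?r (x t) = x t"
  proof eventually_elim
    case (elim t)
    then obtain c where c: "x t = N (u t) *v c" using f by auto
    have "x t $ I i = c $ i" for i unfolding c by (rule I[OF elim(2)])
    then have "?r (x t) = c" by (simp add: vec_eq_iff)
    then show ?case using c by simp
  qed
  have "((\<lambda>t. N (u t) *v ?r (x t)) \<longlongrightarrow> N v *v ?r y) F"
    using twisting_sheaf_tendsto[OF N U(2) u] tendsto_vec_nth[OF x]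
    by (intro tendsto_matrix_vector_mult) auto
  then have "(x \<longlongrightarrow> N v *v ?r y) F"
    using tendsto_cong[OF eq] by simp
  then have "y = N v *v ?r y" using tendsto_unique[OF assms(3) x] by blast
  then show ?thesis using f[OF U(2)] by auto
qed

lemma tendsto_line:
  fixes v w :: "complex^'n"
  shows "((\<lambda>t. v + t *s w) \<longlongrightarrow> v) (at 0)"
proof (rule vec_tendstoI)
  fix i
  have "((\<lambda>t. v $ i + t * w $ i) \<longlongrightarrow> v $ i + 0 * w $ i) (at 0)"
    by (intro tendsto_intros)
  then show "((\<lambda>t. (v + t *s w) $ i) \<longlongrightarrow> v $ i) (at 0)" by simp
qed

text \<open>
  The fibres form a closed family, so a tuple of forms that lies in the fibres over a nonempty basic
  open set, which is dense, lies in all of them.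
\<close>

lemma form_section_extends:
  fixes f :: "'d::finite curve"
  assumes "is_morphism f" and \<sigma>: "\<And>p. binary_form a (\<lambda>v. \<sigma> v $ p)"
    and R: "binary_form b R" "R w \<noteq> 0"
    and mem: "\<And>u. u \<noteq> 0 \<Longrightarrow> R u \<noteq> 0 \<Longrightarrow> \<sigma> u \<in> f (line_through u)"
    and "v \<noteq> 0"
  shows "\<sigma> v \<in> f (line_through v)"
proof (rule fibre_closed[OF assms(1) \<open>v \<noteq> 0\<close> _ tendsto_line])
  let ?u = "\<lambda>t. v + t *s (w - v)"
  have "isCont (\<lambda>v. \<sigma> v $ p) v" for p
    using binary_form_isCont[OF \<sigma>] .
  then show "((\<lambda>t. \<sigma> (?u t)) \<longlongrightarrow> \<sigma> v) (at 0)"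
    by (intro vec_tendstoI isCont_tendsto_compose[OF _ tendsto_line]) auto
  have "\<forall>\<^sub>F t in at 0. ?u t \<noteq> 0"
    using eventually_compose_filterlim[OF eventually_nonzero[OF \<open>v \<noteq> 0\<close>] tendsto_line] .
  then show "\<forall>\<^sub>F t in at 0. \<sigma> (?u t) \<in> f (line_through (?u t))"
    using binary_form_eventually_nonzero[OF R]
    by eventually_elim (rule mem)
qed simp

text \<open>
  The columns of \<open>S\<close> are global sections of the twists \<open>f\<^sup>*S(a_j)\<close>, equivalently a map from
  the direct sum of the \<open>O(-a_j)\<close> to \<open>f\<^sup>*S\<close>; it is an isomorphism if \<open>S v\<close> is injective for
  all \<open>v \<noteq> 0\<close>.
\<close>

definition form_frame ::
    "'d::finite curve \<Rightarrow> ('d \<Rightarrow> nat) \<Rightarrow> (complex^2 \<Rightarrow> complex^'d^('d \<times> 2)) \<Rightarrow> bool" where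
  "form_frame f a S \<longleftrightarrow>
     (\<forall>p j. binary_form (a j) (\<lambda>v. S v $ p $ j)) \<and>
     (\<forall>v. v \<noteq> 0 \<longrightarrow> (\<forall>c. S v *v c \<in> f (line_through v)))"

lemma matrix_vector_mult_columns:
  fixes M :: "complex^'n^'m"
  shows "M *v c = (\<Sum>j\<in>UNIV. c $ j *s column j M)"
  by (simp add: vec_eq_iff matrix_vector_mult_def column_def mult.commute)

lemma matrix_vector_mult_axis:
  fixes M :: "complex^'n^'m"
  shows "M *v axis j 1 = column j M"
  by (simp add: vec_eq_iff matrix_vector_mult_def column_def axis_def if_distrib[of "\<lambda>x. _ * x"] cong: if_cong)

lemma subspace_columns:
  fixes M :: "complex^'n^'m"
  assumes "vec.subspace E" "\<And>j. column j M \<in> E"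
  shows "M *v c \<in> E"
  unfolding matrix_vector_mult_columns
  by (intro vec.subspace_sum vec.subspace_scale assms)

text \<open>
  Clearing the denominators of a chart matrix gives forms, all of the degree of the common
  denominator; they take values in the fibres on the chart, hence everywhere.
\<close>

lemma form_frame_exists:
  fixes f :: "'d::finite curve"
  assumes "is_morphism f"
  obtains a S v where "form_frame f a S" "v \<noteq> 0" "inj ((*v) (S v))"
proof -
  define v :: "complex^2" where "v = axis 1 1"
  have v0: "v \<noteq> 0" by (simp add: v_def)
  obtain U and I :: "'d \<Rightarrow> 'd \<times> 2" and N where U: "zariski_open U" "v \<in> punctured_cone U" "inj I"
    and N: "\<And>p j. (\<lambda>u. N u $ p $ j) \<in> twisting_sheaf 0 U"
    and f: "\<And>u. u \<in> punctured_cone U \<Longrightarrow> f (line_through u) = range ((*v) (N u))"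
    and I: "\<And>u c i. u \<in> punctured_cone U \<Longrightarrow> (N u *v c) $ I i = c $ i"
    by (rule morphism_chart[OF assms v0]) (rule that)
  have "\<exists>a P R. binary_form a P \<and> binary_form a R \<and> R v \<noteq> 0 \<and>
    (\<forall>u. u \<noteq> 0 \<longrightarrow> R u \<noteq> 0 \<longrightarrow> u \<in> punctured_cone U \<and> N u $ p $ j = P u / R u)" for p j
  proof -
    obtain a b P R where "binary_form a P" "binary_form b R" "int a - int b = 0" "R v \<noteq> 0"
      and "\<And>u. u \<noteq> 0 \<Longrightarrow> R u \<noteq> 0 \<Longrightarrow> u \<in> punctured_cone U \<and> N u $ p $ j = P u / R u"
      using twisting_sheaf_fraction[OF N U(2)] by metis
    moreover from this have "a = b" by simp
    ultimately show ?thesis by blast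
  qed
  then obtain a P R where PR: "\<And>p j. binary_form (a p j) (P p j)" "\<And>p j. binary_form (a p j) (R p j)"
    "\<And>p j. R p j v \<noteq> 0" and NPR: "\<And>p j u. u \<noteq> 0 \<Longrightarrow> R p j u \<noteq> 0 \<Longrightarrow>
      u \<in> punctured_cone U \<and> N u $ p $ j = P p j u / R p j u"
    by metis
  define D where "D = (\<lambda>u. \<Prod>(p, j)\<in>UNIV. R p j u)"
  define m where "m = (\<Sum>(p, j)\<in>UNIV. a p j)"
  define S where "S = (\<lambda>u. \<chi> p j. P p j u * (\<Prod>(p', j')\<in>UNIV - {(p, j)}. R p' j' u))"
  have D: "binary_form m D"
    unfolding D_def m_def using binary_form_prod[of UNIV "\<lambda>(p, j). a p j" "\<lambda>(p, j). R p j"] PR(2)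
    by (simp add: case_prod_beta)
  have Dv: "D v \<noteq> 0" using PR(3) by (auto simp: D_def)
  have S_form: "binary_form m (\<lambda>u. S u $ p $ j)" for p j
  proof -
    have "m = a p j + (\<Sum>(p', j')\<in>UNIV - {(p, j)}. a p' j')"
      unfolding m_def by (subst sum.remove[of _ "(p, j)"]) auto
    then show ?thesis
      using binary_form_mult[OF PR(1)[of p j]
          binary_form_prod[of "UNIV - {(p, j)}" "\<lambda>(p, j). a p j" "\<lambda>(p, j). R p j"]] PR(2)
      by (simp add: S_def case_prod_beta)
  qed
  have S_N: "u \<in> punctured_cone U \<and> S u *v c = N u *v (D u *s c)" if u: "u \<noteq> 0" "D u \<noteq> 0" for u c
  proof -
    have "\<forall>q\<in>UNIV. (case q of (p, j) \<Rightarrow> R p j u) \<noteq> 0"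
      using u(2) unfolding D_def by (simp only: prod_zero_iff[OF finite] bex_simps ball_simps) blast
    then have R: "R p j u \<noteq> 0" for p j by (metis UNIV_I case_prod_conv)
    have D_R: "D u = R p j u * (\<Prod>(p', j')\<in>UNIV - {(p, j)}. R p' j' u)" for p j
      unfolding D_def by (subst prod.remove[of _ "(p, j)"]) auto
    have "S u $ p $ j = D u * N u $ p $ j" for p j
      by (subst D_R[of p j]) (use NPR[OF u(1) R[of p j]] R[of p j] in \<open>simp add: S_def\<close>)
    then have "S u *v c = N u *v (D u *s c)"
      by (simp add: vec_eq_iff matrix_vector_mult_def mult_ac)
    then show ?thesis using NPR[OF u(1) R] by blast
  qed
  have "S u *v c \<in> f (line_through u)" if "u \<noteq> 0" for u c
  proof (rule form_section_extends[OF assms _ D Dv _ that])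
    show "binary_form m (\<lambda>v. (S v *v c) $ p)" for p
      unfolding matrix_vector_mult_def vec_lambda_beta mult.commute[of _ "c $ _"]
      by (intro binary_form_sum binary_form_cmult S_form)
    show "S u *v c \<in> f (line_through u)" if "u \<noteq> 0" "D u \<noteq> 0" for u
      using S_N[OF that] f by auto
  qed
  then have "form_frame f (\<lambda>_. m) S" using S_form by (simp add: form_frame_def)
  moreover have "inj ((*v) (S v))"
  proof (rule injI)
    fix c c' assume "S v *v c = S v *v c'"
    then have "N v *v (D v *s c) = N v *v (D v *s c')" using S_N[OF v0 Dv] by simp
    then have "D v *s c = D v *s c'" using I[OF U(2)] by (metis vec_eq_iff)
    then show "c = c'" using Dv by simp
  qed
  ultimately show thesis using that v0 by blast
qed

lemma inj_matrix_iff: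
  fixes M :: "complex^'n^'m::finite"
  shows "inj ((*v) M) \<longleftrightarrow> (\<forall>c. M *v c = 0 \<longrightarrow> c = 0)"
  by (simp add: vec.inj_iff_eq_0)

text \<open>
  If a combination of the columns vanishes at a point, then the corresponding combination of
  forms, homogenized by powers of a linear form, is divisible by the equation of that point. The
  quotient can replace a column of maximal degree and lowers the total degree. So a frame of
  minimal total degree is a basis at every point; this is Grothendieck's splitting theorem for
  \<open>f\<^sup>*S\<close>.
\<close>

lemma form_frame_reduce:
  fixes f :: "'d::finite curve"
  assumes f: "is_morphism f" and S: "form_frame f a S"
    and v1: "v1 \<noteq> 0" "inj ((*v) (S v1))" and x: "x \<noteq> 0" "\<not> inj ((*v) (S x))"
  obtains a' S' where "form_frame f a' S'" "inj ((*v) (S' v1))" "(\<Sum>j\<in>UNIV. a' j) < (\<Sum>j\<in>UNIV. a j)"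
proof -
  have form: "binary_form (a j) (\<lambda>v. S v $ p $ j)" for p j
    using S unfolding form_frame_def by blast
  have mem: "v \<noteq> 0 \<Longrightarrow> S v *v c \<in> f (line_through v)" for v c
    using S by (simp add: form_frame_def)
  obtain c where c: "S x *v c = 0" "c \<noteq> 0" using x(2) by (auto simp: inj_matrix_iff)
  let ?J = "{i. c $ i \<noteq> 0}"
  have "?J \<noteq> {}" using c(2) by (auto simp: vec_eq_iff)
  then obtain j where j: "c $ j \<noteq> 0" and max: "\<And>i. c $ i \<noteq> 0 \<Longrightarrow> a i \<le> a j"
    using Max_in[of "a ` ?J"] Max_ge[of "a ` ?J"] by fastforce
  obtain L0 where L0: "binary_form 1 L0" "L0 x \<noteq> 0"
    using linear_form_nonvanishing[OF x(1)] .
  \<comment> \<open>normalized to be 1 at \<open>x\<close>, so that homogenizing with its powers changes nothing there\<close>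
  define L where "L = (\<lambda>v. inverse (L0 x) * L0 v)"
  have L: "binary_form 1 L" "L x = 1"
    using binary_form_cmult[OF L0(1)] L0(2) by (auto simp: L_def)
  define k where "k = (\<lambda>v. \<chi> i. c $ i * L v ^ (a j - a i))"
  define \<tau> where "\<tau> = (\<lambda>v. S v *v k v)"
  have \<tau>_form: "binary_form (a j) (\<lambda>v. \<tau> v $ p)" for p
  proof -
    have "binary_form (a j) (\<lambda>v. S v $ p $ i * (c $ i * L v ^ (a j - a i)))" for i
    proof (cases "c $ i = 0")
      case False
      then show ?thesis
        using binary_form_mult[OF form[of i p]
            binary_form_cmult[OF binary_form_power[OF L(1), of "a j - a i"], of "c $ i"]] max[OF False] by simp
    qed (simp add: binary_form_zero)
    then show ?thesis
      by (simp add: \<tau>_def k_def matrix_vector_mult_def binary_form_sum)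
  qed
  have \<tau>_x: "\<tau> x = 0"
  proof -
    have "k x = c" by (simp add: k_def L(2) vec_eq_iff)
    then show ?thesis using c(1) by (simp add: \<tau>_def)
  qed
  have k_j: "k v $ j = c $ j" for v by (simp add: k_def)
  have \<tau>_v1: "\<tau> v1 \<noteq> 0"
  proof
    assume "\<tau> v1 = 0"
    then have "k v1 = 0" using v1(2) by (simp add: \<tau>_def inj_matrix_iff)
    then show False using k_j[of v1] j by simp
  qed
  \<comment> \<open>if \<open>a j = 0\<close>, then the combination \<open>\<tau>\<close> is constant\<close>
  have "a j \<noteq> 0"
  proof
    assume "a j = 0"
    then have "\<tau> v1 $ p = \<tau> x $ p" for p
      using \<tau>_form binary_form_degree_0[of "\<lambda>v. \<tau> v $ p"] by metis
    then show False using \<tau>_x \<tau>_v1 by (simp add: vec_eq_iff)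
  qed
  then obtain m where m: "a j = Suc m" using not0_implies_Suc by blast
  let ?D = "\<lambda>v :: complex^2. x$1 * v$2 - x$2 * v$1"
  have "\<exists>R. binary_form m R \<and> (\<forall>v. \<tau> v $ p = ?D v * R v)" for p
    using binary_form_divide[of m "\<lambda>v. \<tau> v $ p" x] \<tau>_form[of p] m x(1) \<tau>_x by (metis zero_index)
  then obtain R where R: "\<And>p. binary_form m (R p)" "\<And>p v. \<tau> v $ p = ?D v * R p v"
    by metis
  define \<sigma> where "\<sigma> = (\<lambda>v. \<chi> p. R p v)"
  have \<tau>_\<sigma>: "\<tau> v = ?D v *s \<sigma> v" for v by (simp only: vec_eq_iff \<sigma>_def R(2) vector_smult_component vec_lambda_beta simp_thms)
  have D_v1: "?D v1 \<noteq> 0" using \<tau>_v1 \<tau>_\<sigma>[of v1] by auto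
  have D_form: "binary_form 1 ?D"
    using binary_form_linear[of "- x$2" "x$1"] by simp
  have \<sigma>_mem: "\<sigma> v \<in> f (line_through v)" if "v \<noteq> 0" for v
  proof (rule form_section_extends[OF f _ D_form D_v1 _ that])
    show "binary_form m (\<lambda>v. \<sigma> v $ p)" for p by (simp add: \<sigma>_def R(1))
    show "\<sigma> u \<in> f (line_through u)" if "u \<noteq> 0" "?D u \<noteq> 0" for u
    proof -
      have "inverse (?D u) *s \<tau> u = (inverse (?D u) * ?D u) *s \<sigma> u"
        by (simp only: \<tau>_\<sigma> vec.scale_scale)
      then have "\<sigma> u = inverse (?D u) *s \<tau> u"
        by (simp only: left_inverse[OF that(2)] vec.scale_one)
      then show ?thesis
        using vec.subspace_scale[OF fibre_subspace[OF f that(1)] mem[OF that(1)]] by (simp add: \<tau>_def)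
    qed
  qed
  define S' where "S' = (\<lambda>v. \<chi> p i. if i = j then \<sigma> v $ p else S v $ p $ i)"
  define a' where "a' = a(j := m)"
  have "form_frame f a' S'"
    unfolding form_frame_def
  proof (intro conjI allI impI)
    fix p i show "binary_form (a' i) (\<lambda>v. S' v $ p $ i)"
      using form R(1) by (simp add: S'_def a'_def \<sigma>_def)
  next
    fix v :: "complex^2" and e assume v: "v \<noteq> 0"
    have "column i (S v) \<in> f (line_through v)" for i
      using mem[OF v, of "axis i 1"] by (simp add: matrix_vector_mult_axis)
    moreover have "column i (S' v) = (if i = j then \<sigma> v else column i (S v))" for i
      by (simp add: vec_eq_iff column_def S'_def)
    ultimately show "S' v *v e \<in> f (line_through v)"
      using \<sigma>_mem[OF v] by (intro subspace_columns fibre_subspace[OF f v]) auto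
  qed
  moreover have "inj ((*v) (S' v1))"
    unfolding inj_matrix_iff
  proof (intro allI impI)
    fix e assume e: "S' v1 *v e = 0"
    define e' where "e' = (\<chi> i. if i = j then 0 else e $ i)"
    have split: "S' v1 *v e = S v1 *v e' + e $ j *s \<sigma> v1"
    proof -
      have "(\<Sum>i\<in>UNIV. S' v1 $ p $ i * e $ i) = (\<Sum>i\<in>UNIV. S v1 $ p $ i * e' $ i) + e $ j * \<sigma> v1 $ p" for p
      proof -
        have "(\<Sum>i\<in>UNIV. S' v1 $ p $ i * e $ i)
            = (\<Sum>i\<in>UNIV. S v1 $ p $ i * e' $ i + (if i = j then e $ j * \<sigma> v1 $ p else 0))"
          by (intro sum.cong) (auto simp: S'_def e'_def)
        then show ?thesis by (simp add: sum.distrib)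
      qed
      then show ?thesis by (simp add: vec_eq_iff matrix_vector_mult_def)
    qed
    define \<delta> where "\<delta> = ?D v1"
    have \<delta>: "\<delta> \<noteq> 0" unfolding \<delta>_def by (rule D_v1)
    have Sk: "S v1 *v k v1 = \<delta> *s \<sigma> v1"
      using \<tau>_\<sigma>[of v1] unfolding \<delta>_def \<tau>_def .
    have "S v1 *v (\<delta> *s e' + e $ j *s k v1) = \<delta> *s (S v1 *v e') + e $ j *s (\<delta> *s \<sigma> v1)"
      by (simp only: matrix_vector_right_distrib vector_scalar_commute Sk)
    also have "\<dots> = \<delta> *s (S' v1 *v e)"
      by (simp only: split vec.scale_right_distrib vec.scale_scale mult.commute)
    finally have z: "\<delta> *s e' + e $ j *s k v1 = 0"
      using e v1(2) by (simp add: inj_matrix_iff)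
    then have "(\<delta> *s e' + e $ j *s k v1) $ j = 0" by simp
    then have "e $ j = 0" using k_j[of v1] j by (simp add: e'_def)
    moreover from this z have "e' = 0" using \<delta> by simp
    ultimately have "e $ i = 0" for i
      by (cases "i = j") (auto simp: e'_def vec_eq_iff split: if_splits)
    then show "e = 0" by (simp add: vec_eq_iff)
  qed
  moreover have "(\<Sum>i\<in>UNIV. a' i) < (\<Sum>i\<in>UNIV. a i)"
    using m by (intro sum_strict_mono_ex1) (auto simp: a'_def)
  ultimately show thesis using that by blast
qed

lemma splitting_frame_exists:
  fixes f :: "'d::finite curve"
  assumes "is_morphism f"
  obtains a S where "form_frame f a S" "\<And>v. v \<noteq> 0 \<Longrightarrow> inj ((*v) (S v))"
proof -
  define Q where "Q = (\<lambda>(a, S). form_frame f a S \<and> (\<exists>v. v \<noteq> 0 \<and> inj ((*v) (S v))))"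
  define deg where "deg = (\<lambda>(a :: 'd \<Rightarrow> nat, S :: complex^2 \<Rightarrow> complex^'d^('d \<times> 2)). \<Sum>j\<in>UNIV. a j)"
  have "\<exists>z. Q z" 
  proof -
    obtain a S v where "form_frame f a S" "v \<noteq> 0" "inj ((*v) (S v))"
      by (rule form_frame_exists[OF assms])
    then have "Q (a, S)" by (auto simp: Q_def)
    then show ?thesis by blast
  qed
  then obtain z where z: "Q z" "\<And>z'. Q z' \<Longrightarrow> deg z \<le> deg z'"
    using ex_has_least_nat[of Q _ deg] by metis
  obtain a S where aS: "z = (a, S)" by (cases z)
  obtain v1 where v1: "form_frame f a S" "v1 \<noteq> 0" "inj ((*v) (S v1))"
    using z(1) by (auto simp: Q_def aS)
  have "inj ((*v) (S x))" if x: "x \<noteq> 0" for x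
  proof (rule ccontr)
    assume "\<not> inj ((*v) (S x))"
    then obtain a' S' where "form_frame f a' S'" "inj ((*v) (S' v1))"
      and lt: "(\<Sum>j\<in>UNIV. a' j) < (\<Sum>j\<in>UNIV. a j)"
      by (rule form_frame_reduce[OF assms v1 x])
    then have "Q (a', S')" using v1(2) unfolding Q_def by blast
    then show False using z(2)[of "(a', S')"] lt by (simp add: deg_def aS)
  qed
  then show thesis using that v1(1) by blast
qed

text \<open>
  In a chart the rows \<open>I\<close> of \<open>S\<close> form a square matrix, and \<open>S\<close> is the product of the chart
  matrix with it. So injectivity of \<open>S v\<close> makes this square matrix invertible.
\<close>

lemma form_frame_minor:
  fixes f :: "'d::finite curve"
  assumes "is_morphism f" "form_frame f a S" "v \<noteq> 0" "inj ((*v) (S v))"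
  obtains I where "det (\<chi> i j. S v $ I i $ j) \<noteq> 0" "f (line_through v) = range ((*v) (S v))"
proof -
  obtain U and I :: "'d \<Rightarrow> 'd \<times> 2" and N where U: "zariski_open U" "v \<in> punctured_cone U" "inj I"
    and N: "\<And>p j. (\<lambda>u. N u $ p $ j) \<in> twisting_sheaf 0 U"
    and f: "\<And>u. u \<in> punctured_cone U \<Longrightarrow> f (line_through u) = range ((*v) (N u))"
    and I: "\<And>u c i. u \<in> punctured_cone U \<Longrightarrow> (N u *v c) $ I i = c $ i"
    by (rule morphism_chart[OF assms(1,3)]) (rule that)
  define B where "B = (\<chi> i j. S v $ I i $ j)"
  have S: "S v *v c = N v *v (B *v c)" for c
  proof -
    have "S v *v c \<in> f (line_through v)" using assms(2,3) by (simp add: form_frame_def)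
    then obtain e where e: "S v *v c = N v *v e" using f[OF U(2)] by auto
    have "e $ i = (B *v c) $ i" for i
    proof -
      have "e $ i = (S v *v c) $ I i" using I[OF U(2), of e i] by (simp add: e)
      then show ?thesis by (simp add: B_def matrix_vector_mult_def)
    qed
    then have "e = B *v c" by (simp add: vec_eq_iff)
    then show ?thesis using e by simp
  qed
  have "B *v c = 0 \<Longrightarrow> c = 0" for c
    using S[of c] assms(4) by (simp add: inj_matrix_iff)
  then have "\<exists>C. C ** B = mat 1" unfolding matrix_left_invertible_ker by blast
  then have inv: "invertible B" by (simp add: invertible_left_inverse)
  then obtain C where C: "B ** C = mat 1" by (auto simp: invertible_def)
  have "f (line_through v) = range ((*v) (S v))"
  proof
    show "f (line_through v) \<subseteq> range ((*v) (S v))"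
    proof
      fix y assume "y \<in> f (line_through v)"
      then obtain e where "y = N v *v e" using f[OF U(2)] by auto
      also have "e = B *v (C *v e)" by (simp add: matrix_vector_mul_assoc C)
      finally have "y = S v *v (C *v e)" by (simp add: S)
      then show "y \<in> range ((*v) (S v))" by blast
    qed
    show "range ((*v) (S v)) \<subseteq> f (line_through v)"
      using assms(2,3) by (auto simp: form_frame_def)
  qed
  moreover have "det B \<noteq> 0" using inv by (simp add: invertible_det_nz)
  ultimately show thesis using that by (simp add: B_def)
qed


section \<open>The degree of a line bundle\<close>

text \<open>For \<open>e < 0\<close> the entire function \<open>F\<close> would tend to 0 at infinity.\<close>

lemma gluing_exponent_not_negative:
  fixes F G :: "complex \<Rightarrow> complex"
  assumes "F holomorphic_on UNIV" "F 0 \<noteq> 0" "isCont G 0"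
    and glue: "\<And>z. z \<noteq> 0 \<Longrightarrow> F z = z powi e * G (inverse z)"
  shows "e \<ge> 0"
proof (rule ccontr)
  assume "\<not> e \<ge> 0"
  then obtain k where k: "e = - int (Suc k)" by (metis not_le negD)
  have inv: "((inverse :: complex \<Rightarrow> complex) \<longlongrightarrow> 0) at_infinity" by (rule tendsto_inverse_0)
  have "((\<lambda>z. inverse z ^ Suc k * G (inverse z)) \<longlongrightarrow> 0 ^ Suc k * G 0) at_infinity"
    using inv isCont_tendsto_compose[OF assms(3) inv] by (intro tendsto_mult tendsto_power)
  then have lim: "((\<lambda>z. inverse z ^ Suc k * G (inverse z)) \<longlongrightarrow> 0) at_infinity" by simp
  have "\<forall>\<^sub>F z in at_infinity. inverse z ^ Suc k * G (inverse z) = F z"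
    using eventually_not_equal_at_infinity[of 0]
    by eventually_elim (simp add: glue k power_int_minus power_inverse del: of_nat_Suc power_Suc)
  then have "(F \<longlongrightarrow> 0) at_infinity"
    using lim tendsto_cong[of "\<lambda>z. inverse z ^ Suc k * G (inverse z)" F] by simp
  then have "F 0 = 0" by (rule Liouville_weak_0[OF assms(1)])
  then show False using assms(2) by blast
qed

text \<open>
  \<open>F\<close> and \<open>G\<close> are the values of a nowhere vanishing section of \<open>O(e)\<close> in the two standard
  charts. Its inverse is a section of \<open>O(-e)\<close>, so the previous lemma applies to both.
\<close>

lemma gluing_exponent_zero:
  fixes F G :: "complex \<Rightarrow> complex"
  assumes F: "F holomorphic_on UNIV" "\<And>z. F z \<noteq> 0" and G: "isCont G 0" "G 0 \<noteq> 0"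
    and glue: "\<And>z. z \<noteq> 0 \<Longrightarrow> F z = z powi e * G (inverse z)"
  shows "e = 0"
proof (rule antisym)
  show "e \<ge> 0" using gluing_exponent_not_negative[OF F G(1) glue] .
  have "(\<lambda>z. inverse (F z)) holomorphic_on UNIV"
    using F by (intro holomorphic_intros) auto
  moreover have "isCont (\<lambda>z. inverse (G z)) 0"
    using G by (intro continuous_intros)
  moreover have "inverse (F z) = z powi (- e) * inverse (G (inverse z))" if "z \<noteq> 0" for z
    using glue[OF that] by (simp add: power_int_minus)
  ultimately have "- e \<ge> 0"
    using F(2) by (intro gluing_exponent_not_negative[of "\<lambda>z. inverse (F z)" "\<lambda>z. inverse (G z)"]) auto
  then show "e \<le> 0" by simp
qed

lemma coordinate_form: "binary_form 1 (\<lambda>v :: complex^2. v $ i)"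
  using binary_form_linear[of 1 0] binary_form_linear[of 0 1] exhaust_2[of i] by auto

lemma coordinate_power_section:
  assumes "zariski_open U" "\<And>v. v \<in> punctured_cone U \<Longrightarrow> v $ i \<noteq> 0"
  shows "(\<lambda>v. if v \<in> punctured_cone U then (v $ i) powi m else 0) \<in> twisting_sheaf m U"
proof -
  have pos: "(\<lambda>v. if v \<in> punctured_cone U then (v $ i) ^ k else 0) \<in> twisting_sheaf (int k) U" for k
    using twisting_sheaf_form[OF assms(1) binary_form_power[OF coordinate_form[of i], of k]] by simp
  show ?thesis
  proof (cases "m \<ge> 0")
    case True
    then show ?thesis using pos[of "nat m"] by (simp add: power_int_def cong: if_cong)
  next
    case False
    have "(\<lambda>v. inverse (if v \<in> punctured_cone U then (v $ i) ^ nat (- m) else 0)) \<in> twisting_sheaf (- int (nat (- m))) U"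
      using assms by (intro twisting_sheaf_inverse pos) auto
    also have "(\<lambda>v. inverse (if v \<in> punctured_cone U then (v $ i) ^ nat (- m) else 0)) =
        (\<lambda>v. if v \<in> punctured_cone U then (v $ i) powi m else 0)"
      using False by (auto simp: power_int_def power_inverse)
    finally show ?thesis using False by simp
  qed
qed

text \<open>
  The map \<open>h \<mapsto> h p\<close> identifies \<open>O(-n)\<close> with the sheaf of sections of such a line bundle, because
  the generator \<open>p\<close> has no zeros.
\<close>

locale generated_line_bundle =
  fixes E :: "(complex^2) set \<Rightarrow> (complex^'m::finite) set" and n :: nat and p :: "complex^2 \<Rightarrow> complex^'m"
  assumes p_form: "\<And>I. binary_form n (\<lambda>v. p v $ I)"
    and p_nonzero: "\<And>v. v \<noteq> 0 \<Longrightarrow> p v \<noteq> 0"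
    and E_span: "\<And>v. v \<noteq> 0 \<Longrightarrow> E (line_through v) = vec.span {p v}"
begin

text \<open>
  The coefficient of a multiple of \<open>p v\<close>, by orthogonal projection. This formula is linear in \<open>x\<close>
  and requires no choice of a coordinate; on multiples of \<open>p\<close> it agrees near each point with
  division by a coordinate of \<open>p\<close>, which shows that it is regular.
\<close>

definition coefficient :: "complex^2 \<Rightarrow> complex^'m \<Rightarrow> complex" where
  "coefficient v x = (\<Sum>I\<in>UNIV. cnj (p v $ I) * x $ I) / (\<Sum>I\<in>UNIV. cnj (p v $ I) * p v $ I)"

lemma coefficient_multiple:
  assumes "v \<noteq> 0"
  shows "coefficient v (c *s p v) = c"
proof -
  have "(\<Sum>I\<in>UNIV. cnj (p v $ I) * p v $ I) = of_real (\<Sum>I\<in>UNIV. (cmod (p v $ I))\<^sup>2)"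
    by (simp add: complex_norm_square mult.commute del: of_real_power)
  moreover have "(\<Sum>I\<in>UNIV. (cmod (p v $ I))\<^sup>2) \<noteq> 0"
    using p_nonzero[OF assms] by (simp add: sum_nonneg_eq_0_iff vec_eq_iff)
  ultimately have "(\<Sum>I\<in>UNIV. cnj (p v $ I) * p v $ I) \<noteq> 0" by (simp only: of_real_eq_0_iff simp_thms)
  moreover have "(\<Sum>I\<in>UNIV. cnj (p v $ I) * (c *s p v) $ I) = c * (\<Sum>I\<in>UNIV. cnj (p v $ I) * p v $ I)"
    by (simp add: sum_distrib_left mult_ac)
  ultimately show ?thesis by (simp add: coefficient_def)
qed

lemma coefficient_add: "coefficient v (x + y) = coefficient v x + coefficient v y"
  by (simp add: coefficient_def sum.distrib algebra_simps add_divide_distrib)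

lemma coefficient_scale: "coefficient v (c *s x) = c * coefficient v x"
  by (simp add: coefficient_def sum_distrib_left mult_ac)

lemma coefficient_zero: "coefficient v 0 = 0"
  by (simp add: coefficient_def)

lemma multiple_section:
  assumes "zariski_open U" "h \<in> twisting_sheaf (- int n) U"
  shows "(\<lambda>v. h v *s p v) \<in> subbundle_sheaf E U"
proof -
  have "(\<lambda>v. (h v *s p v) $ I) \<in> twisting_sheaf 0 U" for I
  proof -
    have "(\<lambda>v. h v * (if v \<in> punctured_cone U then p v $ I else 0)) \<in> twisting_sheaf (- int n + int n) U"
      by (intro twisting_sheaf_mult twisting_sheaf_form assms p_form)
    also have "(\<lambda>v. h v * (if v \<in> punctured_cone U then p v $ I else 0)) = (\<lambda>v. (h v *s p v) $ I)"
      using twisting_sheaf_outside[OF assms(2)] by (auto simp: fun_eq_iff)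
    finally show ?thesis by simp
  qed
  moreover have "h v *s p v \<in> E (line_through v)" if "v \<in> punctured_cone U" for v
    using E_span[OF punctured_cone_nonzero[OF that]] by (auto simp: vec.span_singleton)
  ultimately show ?thesis by (simp add: subbundle_sheaf_def twist_sum_def)
qed

lemma section_outside:
  assumes "s \<in> subbundle_sheaf E U" "v \<notin> punctured_cone U"
  shows "s v = 0"
proof -
  have "(\<lambda>v. s v $ I) \<in> twisting_sheaf 0 U" for I
    using assms(1) by (simp add: subbundle_sheaf_def twist_sum_def)
  then have "s v $ I = 0" for I
    using assms(2) by (rule twisting_sheaf_outside)
  then show ?thesis by (simp add: vec_eq_iff)
qed

lemma section_multiple:
  assumes "s \<in> subbundle_sheaf E U"
  shows "s v = coefficient v (s v) *s p v"
proof (cases "v \<in> punctured_cone U")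
  case True
  then have v: "v \<noteq> 0" by (rule punctured_cone_nonzero)
  have "s v \<in> vec.span {p v}"
    using assms True E_span[OF v] by (auto simp: subbundle_sheaf_def)
  then obtain c where "s v = c *s p v" by (auto simp: vec.span_singleton)
  then show ?thesis by (simp add: coefficient_multiple[OF v])
next
  case False
  then show ?thesis using section_outside[OF assms] by (simp add: coefficient_zero)
qed

lemma coefficient_section:
  assumes "zariski_open U" "s \<in> subbundle_sheaf E U"
  shows "(\<lambda>v. coefficient v (s v)) \<in> twisting_sheaf (- int n) U"
proof (rule twisting_sheafI[OF assms(1)])
  show "coefficient v (s v) = 0" if "v \<notin> punctured_cone U" for v
    using section_outside[OF assms(2) that] by (simp add: coefficient_zero)
next
  fix v assume v: "v \<in> punctured_cone U"
  obtain I where I: "p v $ I \<noteq> 0"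
    using p_nonzero[OF punctured_cone_nonzero[OF v]] by (auto simp: vec_eq_iff)
  have "(\<lambda>v. s v $ I) \<in> twisting_sheaf 0 U"
    using assms(2) by (simp add: subbundle_sheaf_def twist_sum_def)
  from twisting_sheaf_fraction[OF this v] obtain a b P R where PR: "binary_form a P" "binary_form b R" "int a - int b = 0" "R v \<noteq> 0"
    and s: "\<And>u. u \<noteq> 0 \<Longrightarrow> R u \<noteq> 0 \<Longrightarrow> u \<in> punctured_cone U \<and> s u $ I = P u / R u"
    by metis
  show "fraction_at (- int n) U (\<lambda>v. coefficient v (s v)) v"
  proof (rule fraction_atI[OF PR(1) binary_form_mult[OF PR(2) p_form[of I]]])
    fix u assume u: "u \<in> punctured_cone U" "R u * p u $ I \<noteq> 0"
    have "s u $ I = coefficient u (s u) * p u $ I"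
      using section_multiple[OF assms(2), of u] by (metis vector_smult_component)
    then show "coefficient u (s u) = P u / (R u * p u $ I)"
      using s[OF punctured_cone_nonzero[OF u(1)]] u(2) by (simp add: field_simps)
  qed (use PR I in auto)
qed

lemma sheaf_iso_twist: "sheaf_iso (subbundle_sheaf E) (twist_sum (\<lambda>_::1. - int n))"
  unfolding sheaf_iso_def
proof (intro exI[of _ "\<lambda>U s v. \<chi> _. coefficient v (s v)"] allI impI conjI ballI)
  fix U :: "(complex^2) set set" assume U: "zariski_open U"
  show "bij_betw (\<lambda>s v. (\<chi> _. coefficient v (s v)) :: complex^1) (subbundle_sheaf E U) (twist_sum (\<lambda>_::1. - int n) U)"
  proof (rule bij_betw_byWitness[where f' = "\<lambda>t v. t v $ 1 *s p v"])
    show "\<forall>s\<in>subbundle_sheaf E U. (\<lambda>v. ((\<chi> _. coefficient v (s v)) :: complex^1) $ 1 *s p v) = s"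
      using section_multiple by (auto simp: fun_eq_iff)
    show "\<forall>t\<in>twist_sum (\<lambda>_::1. - int n) U. (\<lambda>v. \<chi> _. coefficient v (t v $ 1 *s p v)) = t"
    proof (intro ballI ext)
      fix t :: "complex^2 \<Rightarrow> complex^1" and v
      assume "t \<in> twist_sum (\<lambda>_. - int n) U"
      then have t: "(\<lambda>v. t v $ 1) \<in> twisting_sheaf (- int n) U" by (simp add: twist_sum_def)
      have "coefficient v (t v $ 1 *s p v) = t v $ 1"
      proof (cases "v \<in> punctured_cone U")
        case True
        then show ?thesis by (simp add: coefficient_multiple punctured_cone_nonzero)
      next
        case False
        then show ?thesis using twisting_sheaf_outside[OF t] by (simp add: coefficient_zero)
      qed
      then show "(\<chi> _. coefficient v (t v $ 1 *s p v)) = t v" by (simp add: vec_eq_iff forall_1)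
    qed
    show "(\<lambda>s v. (\<chi> _. coefficient v (s v)) :: complex^1) ` subbundle_sheaf E U \<subseteq> twist_sum (\<lambda>_. - int n) U"
      using coefficient_section[OF U] by (auto simp: twist_sum_def)
    show "(\<lambda>t v. t v $ 1 *s p v) ` twist_sum (\<lambda>_::1. - int n) U \<subseteq> subbundle_sheaf E U"
      using multiple_section[OF U] by (auto simp: twist_sum_def)
  qed
qed (auto simp: fun_eq_iff vec_eq_iff coefficient_add coefficient_scale coefficient_zero restrict_section_def)

text \<open>
  The image of the generator \<open>v_i^(-n) p\<close> over \<open>v_i \<noteq> 0\<close> has no zeros, because the isomorphism
  is linear and the sheaf \<open>O(m)\<close> has a section without zeros there. The two images, multiplied by
  \<open>v_i^n\<close>, agree on the overlap and give a section of \<open>O(m + n)\<close> without zeros.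
\<close>

lemma sheaf_iso_degree_unique:
  assumes "sheaf_iso (subbundle_sheaf E) (twist_sum (\<lambda>_::1. m))"
  shows "m = - int n"
proof -
  obtain \<phi> :: "(complex^2) set set \<Rightarrow> (complex^2 \<Rightarrow> complex^'m) \<Rightarrow> complex^2 \<Rightarrow> complex^1" where
    \<phi>: "\<forall>U. zariski_open U \<longrightarrow>
        bij_betw (\<phi> U) (subbundle_sheaf E U) (twist_sum (\<lambda>_. m) U) \<and>
        (\<forall>s\<in>subbundle_sheaf E U. \<forall>t\<in>subbundle_sheaf E U. \<phi> U (\<lambda>v. s v + t v) = (\<lambda>v. \<phi> U s v + \<phi> U t v)) \<and>
        (\<forall>h\<in>twisting_sheaf 0 U. \<forall>s\<in>subbundle_sheaf E U. \<phi> U (\<lambda>v. h v *s s v) = (\<lambda>v. h v *s \<phi> U s v)) \<and>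
        (\<forall>V. zariski_open V \<and> V \<subseteq> U \<longrightarrow>
           (\<forall>s\<in>subbundle_sheaf E U. \<phi> V (restrict_section V s) = restrict_section V (\<phi> U s)))"
    using assms unfolding sheaf_iso_def by (rule exE)
  have bij: "\<And>U. zariski_open U \<Longrightarrow> bij_betw (\<phi> U) (subbundle_sheaf E U) (twist_sum (\<lambda>_. m) U)"
    and scale: "\<And>U h s. zariski_open U \<Longrightarrow> h \<in> twisting_sheaf 0 U \<Longrightarrow> s \<in> subbundle_sheaf E U \<Longrightarrow>
      \<phi> U (\<lambda>v. h v *s s v) = (\<lambda>v. h v *s \<phi> U s v)"
    and restr: "\<And>U V s. zariski_open U \<Longrightarrow> zariski_open V \<Longrightarrow> V \<subseteq> U \<Longrightarrow> s \<in> subbundle_sheaf E U \<Longrightarrow>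
      \<phi> V (restrict_section V s) = restrict_section V (\<phi> U s)"
    using \<phi> by simp_all
  define U where "U = (\<lambda>i. {l \<in> P1. \<exists>v\<in>l. v $ i \<noteq> 0})"
  have U: "zariski_open (U i)" and cone_U: "punctured_cone (U i) = {v. v $ i \<noteq> 0}" for i
    unfolding U_def using zariski_open_basic[OF coordinate_form] punctured_cone_basic[OF coordinate_form]
    by auto
  define e where "e = (\<lambda>k i (v :: complex^2). if v \<in> punctured_cone (U i) then (v $ i) powi k else 0)"
  have e: "e k i \<in> twisting_sheaf k (U i)" for k i
    unfolding e_def by (rule coordinate_power_section[OF U]) (simp add: cone_U)
  define \<alpha> where "\<alpha> = (\<lambda>i v. \<phi> (U i) (\<lambda>v. e (- int n) i v *s p v) v $ 1)"
  have ep: "(\<lambda>v. e (- int n) i v *s p v) \<in> subbundle_sheaf E (U i)" for i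
    by (rule multiple_section[OF U e])
  have \<alpha>: "\<alpha> i \<in> twisting_sheaf m (U i)" for i
    using bij_betwE[OF bij[OF U[of i]]] ep by (auto simp: \<alpha>_def twist_sum_def)
  have \<alpha>_nonzero: "\<alpha> i v \<noteq> 0" if v: "v $ i \<noteq> 0" for i v
  proof -
    have "(\<lambda>v. \<chi> _. e m i v) \<in> twist_sum (\<lambda>_::1. m) (U i)"
      using e by (simp add: twist_sum_def)
    then obtain s where s: "s \<in> subbundle_sheaf E (U i)" "\<phi> (U i) s = (\<lambda>v. \<chi> _. e m i v)"
      using bij_betw_imp_surj_on[OF bij[OF U[of i]]] by (metis (no_types, lifting) imageE)
    let ?h = "\<lambda>v. coefficient v (s v)"
    have h: "?h \<in> twisting_sheaf (- int n) (U i)" by (rule coefficient_section[OF U s(1)])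
    have k: "(\<lambda>v. ?h v * e (int n) i v) \<in> twisting_sheaf 0 (U i)"
      using twisting_sheaf_mult[OF U h e[of "int n"]] by simp
    have "s v = (?h v * e (int n) i v) *s (e (- int n) i v *s p v)" for v
    proof (cases "v \<in> punctured_cone (U i)")
      case True
      then have "e (int n) i v * e (- int n) i v = 1"
        by (simp add: e_def cone_U power_int_minus)
      then show ?thesis
        using section_multiple[OF s(1), of v] by (simp add: mult.assoc)
    next
      case False
      then show ?thesis using section_outside[OF s(1)] by (simp add: e_def)
    qed
    then have "s = (\<lambda>v. (?h v * e (int n) i v) *s (e (- int n) i v *s p v))" by blast
    then have "\<phi> (U i) s = (\<lambda>v. (?h v * e (int n) i v) *s \<phi> (U i) (\<lambda>v. e (- int n) i v *s p v) v)"
      using scale[OF U k ep] by metis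
    then have "\<phi> (U i) s v $ 1 = (?h v * e (int n) i v) * \<alpha> i v" by (simp add: \<alpha>_def)
    moreover have "\<phi> (U i) s v $ 1 \<noteq> 0" using v by (simp add: s(2) e_def cone_U)
    ultimately show ?thesis by auto
  qed
  have glue: "\<alpha> 2 v * (v $ 2) ^ n = \<alpha> 1 v * (v $ 1) ^ n" if v: "v $ 1 \<noteq> 0" "v $ 2 \<noteq> 0" for v
  proof -
    define W where "W = {l \<in> P1. \<exists>v\<in>l. v $ 1 * v $ 2 \<noteq> 0}"
    have W_form: "binary_form (1 + 1) (\<lambda>v :: complex^2. v $ 1 * v $ 2)"
      by (intro binary_form_mult coordinate_form)
    have W_open: "zariski_open W" unfolding W_def by (rule zariski_open_basic[OF W_form])
    have cone_W: "punctured_cone W = {v. v $ 1 \<noteq> 0 \<and> v $ 2 \<noteq> 0}"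
      unfolding W_def punctured_cone_basic[OF W_form] by auto
    have sub: "W \<subseteq> U i" for i using exhaust_2[of i] by (auto simp: U_def W_def)
    define k where "k = (\<lambda>v. (if v \<in> punctured_cone W then (v $ 1) powi int n else 0) *
      (if v \<in> punctured_cone W then (v $ 2) powi (- int n) else 0))"
    have "(\<lambda>v. if v \<in> punctured_cone W then (v $ 1) powi int n else 0) \<in> twisting_sheaf (int n) W"
      by (rule coordinate_power_section[OF W_open]) (simp add: cone_W)
    moreover have "(\<lambda>v. if v \<in> punctured_cone W then (v $ 2) powi (- int n) else 0) \<in> twisting_sheaf (- int n) W"
      by (rule coordinate_power_section[OF W_open]) (simp add: cone_W)
    ultimately have "k \<in> twisting_sheaf (int n + - int n) W"
      unfolding k_def by (rule twisting_sheaf_mult[OF W_open])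
    then have k: "k \<in> twisting_sheaf 0 W" by simp
    let ?s = "\<lambda>i v. e (- int n) i v *s p v"
    have e_W: "(\<lambda>v. if v \<in> punctured_cone W then e (- int n) 1 v else 0) \<in> twisting_sheaf (- int n) W"
    proof -
      have "(\<lambda>v. if v \<in> punctured_cone W then e (- int n) 1 v else 0)
          = (\<lambda>v. if v \<in> punctured_cone W then (v $ 1) powi (- int n) else 0)"
        by (auto simp: e_def cone_W cone_U)
      also have "\<dots> \<in> twisting_sheaf (- int n) W"
        by (rule coordinate_power_section[OF W_open]) (simp add: cone_W)
      finally show ?thesis .
    qed
    have r1: "restrict_section W (?s 1) \<in> subbundle_sheaf E W"
    proof -
      have "restrict_section W (?s 1) = (\<lambda>v. (if v \<in> punctured_cone W then e (- int n) 1 v else 0) *s p v)"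
        by (auto simp: restrict_section_def)
      then show ?thesis using multiple_section[OF W_open e_W] by simp
    qed
    have "restrict_section W (?s 2) = (\<lambda>v. k v *s restrict_section W (?s 1) v)"
      by (auto simp: restrict_section_def k_def e_def cone_U cone_W power_int_minus fun_eq_iff)
    then have "\<phi> W (restrict_section W (?s 2)) = (\<lambda>v. k v *s \<phi> W (restrict_section W (?s 1)) v)"
      using scale[OF W_open k r1] by simp
    then have "restrict_section W (\<phi> (U 2) (?s 2)) = (\<lambda>v. k v *s restrict_section W (\<phi> (U 1) (?s 1)) v)"
      using restr[OF U W_open sub ep] by simp
    from fun_cong[OF this, of v]
    have "restrict_section W (\<phi> (U 2) (?s 2)) v $ 1 = k v * restrict_section W (\<phi> (U 1) (?s 1)) v $ 1"
      by (simp only: vector_smult_component)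
    then have "\<alpha> 2 v = k v * \<alpha> 1 v"
      using v by (simp add: restrict_section_def cone_W \<alpha>_def)
    then show ?thesis
      using v by (simp add: k_def cone_W power_int_minus field_simps)
  qed
  \<comment> \<open>the glued section in the charts \<open>v_2 = 1\<close> and \<open>v_1 = 1\<close>\<close>
  define F where "F = (\<lambda>z. \<alpha> 2 (axis 2 1 + z *s axis 1 1))"
  define G where "G = (\<lambda>z. \<alpha> 1 (axis 1 1 + z *s axis 2 1))"
  have "F holomorphic_on UNIV"
    unfolding holomorphic_on_def F_def
    using twisting_sheaf_differentiable[OF \<alpha>] by (auto simp: cone_U axis_def)
  moreover have "F z \<noteq> 0" for z unfolding F_def by (rule \<alpha>_nonzero) (simp add: axis_def)
  moreover have "isCont G 0"
    unfolding G_def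
    using field_differentiable_imp_continuous_at[OF twisting_sheaf_differentiable[OF \<alpha>]]
    by (auto simp: cone_U axis_def)
  moreover have "G 0 \<noteq> 0" unfolding G_def by (rule \<alpha>_nonzero) (simp add: axis_def)
  moreover have "F z = z powi (m + int n) * G (inverse z)" if z: "z \<noteq> 0" for z
  proof -
    let ?v = "axis 2 1 + z *s axis 1 1 :: complex^2"
    let ?w = "axis 1 1 + inverse z *s axis 2 1 :: complex^2"
    have v: "?v $ 1 = z" "?v $ 2 = 1" by (simp_all add: axis_def)
    have vw: "?v = z *s ?w" using z by (simp add: vec_eq_iff axis_def)
    have "?w \<in> punctured_cone (U 1)" by (simp add: cone_U axis_def)
    then have "\<alpha> 1 ?v = z powi m * \<alpha> 1 ?w"
      unfolding vw by (rule twisting_sheaf_homogeneous[OF \<alpha> _ z])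
    moreover have "\<alpha> 2 ?v = \<alpha> 1 ?v * z ^ n" using glue[of ?v] v z by simp
    ultimately show ?thesis using z by (simp add: F_def G_def power_int_add)
  qed
  ultimately have "m + int n = 0" by (rule gluing_exponent_zero)
  then show ?thesis by simp
qed

lemma line_bundle_degree_eq: "line_bundle_degree (subbundle_sheaf E) = - int n"
  unfolding line_bundle_degree_def
  using sheaf_iso_twist sheaf_iso_degree_unique by (rule the_equality)

end


section \<open>The differential\<close>

text \<open>
  In both charts the derivative is taken along a line through \<open>v\<close> transversal to \<open>v\<close>; only this
  and the nonvanishing of the factor matter for the determinant.
\<close>

lemma ext_deriv_direction:
  fixes v :: "complex^2"
  assumes "v \<noteq> 0"
  obtains e :: "complex^2" and \<kappa> where "v$1 * e$2 - v$2 * e$1 \<noteq> 0" "\<kappa> \<noteq> 0"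
    "\<And>h. ext_deriv h v = \<kappa> * deriv (\<lambda>t. h (v + t *s e)) 0"
proof (cases "v$1 = 0")
  case False
  have "(vector [v$1, v$2 + t] :: complex^2) = v + t *s axis 2 1" for t
    by (simp add: vec_eq_iff forall_2 axis_def)
  then have "ext_deriv h v = 1 / v$1 * deriv (\<lambda>t. h (v + t *s axis 2 1)) 0" for h
    using False deriv_shift_0[of "\<lambda>z. h (vector [v$1, z])" "v$2"] by (simp add: ext_deriv_def o_def)
  then show thesis using that[of "axis 2 1" "1 / v$1"] False by (simp add: axis_def)
next
  case True
  then have v2: "v$2 \<noteq> 0" using assms by (simp add: vec_eq_iff forall_2)
  have "(vector [v$1 + t, v$2] :: complex^2) = v + t *s axis 1 1" for t
    by (simp add: vec_eq_iff forall_2 axis_def)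
  then have "ext_deriv h v = - 1 / v$2 * deriv (\<lambda>t. h (v + t *s axis 1 1)) 0" for h
    using True deriv_shift_0[of "\<lambda>z. h (vector [z, v$2])" "v$1"] by (simp add: ext_deriv_def o_def)
  then show thesis using that[of "axis 1 1" "- 1 / v$2"] v2 by (simp add: axis_def)
qed

lemma quotient_class_eq_iff:
  assumes "vec.subspace E"
  shows "quotient_class E u = quotient_class E w \<longleftrightarrow> u - w \<in> E"
proof
  assume "quotient_class E u = quotient_class E w"
  moreover have "u \<in> quotient_class E u"
    using vec.subspace_0[OF assms] unfolding quotient_class_def by (intro image_eqI[of _ _ 0]) auto
  ultimately obtain x where "u = w + x" "x \<in> E" by (auto simp: quotient_class_def)
  then show "u - w \<in> E" by simp
next
  have *: "quotient_class E u \<subseteq> quotient_class E w" if "u - w \<in> E" for u w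
  proof
    fix z assume "z \<in> quotient_class E u"
    then obtain x where x: "z = u + x" "x \<in> E" by (auto simp: quotient_class_def)
    then have "z = w + ((u - w) + x)" "(u - w) + x \<in> E"
      using vec.subspace_add[OF assms that] by simp_all
    then show "z \<in> quotient_class E w" unfolding quotient_class_def by blast
  qed
  assume uw: "u - w \<in> E"
  then have "w - u \<in> E" using vec.subspace_neg[OF assms] by (metis minus_diff_eq)
  then show "quotient_class E u = quotient_class E w" using * uw by blast
qed

text \<open>
  For a curve \<open>\<tau>\<close> in \<open>f\<^sup>*S\<close> with \<open>\<tau>(0) = 0\<close> the quotients \<open>\<tau>(t) / t\<close> lie in the fibres, so
  their limit \<open>\<tau>'(0)\<close> lies in the fibre too.
\<close>

lemma derivative_in_fibre:
  fixes f :: "'d::finite curve"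
  assumes "is_morphism f" "v \<noteq> 0" "\<tau> 0 = 0"
    and mem: "\<forall>\<^sub>F t in at 0. \<tau> t \<in> f (line_through (v + t *s e))"
    and deriv: "\<And>p. ((\<lambda>t. \<tau> t $ p) has_field_derivative \<tau>' $ p) (at 0)"
  shows "\<tau>' \<in> f (line_through v)"
proof (rule fibre_closed[OF assms(1,2) _ tendsto_line])
  show "((\<lambda>t. inverse t *s \<tau> t) \<longlongrightarrow> \<tau>') (at 0)"
    using deriv assms(3) by (intro vec_tendstoI) (simp add: has_field_derivative_iff field_simps)
  have "\<forall>\<^sub>F t in at 0. v + t *s e \<noteq> 0"
    using eventually_compose_filterlim[OF eventually_nonzero[OF assms(2)] tendsto_line] .
  with mem show "\<forall>\<^sub>F t in at 0. inverse t *s \<tau> t \<in> f (line_through (v + t *s e))"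
    by eventually_elim (rule vec.subspace_scale[OF fibre_subspace[OF assms(1)]])
qed simp

text \<open>
  \<open>\<Delta>(f)(v) \<noteq> 0\<close> means that the differential is injective on the fibre at \<open>v\<close>. The differential of
  \<open>\<sigma>\<close> modulo the fibre depends only on \<open>\<sigma>(0) = \<Sum>c_j s_j(v)\<close>: the difference of
  \<open>\<sigma>\<close> and \<open>\<Sum>c_j s_j\<close> with constant \<open>c_j\<close> vanishes at \<open>v\<close>.
\<close>

lemma Delta_nonzero_injective:
  fixes f :: "'d::finite curve"
  assumes f: "is_morphism f" and U: "zariski_open U" "v \<in> punctured_cone U"
    and s: "frame_S f U s" and q: "frame_Q f U q" and Delta: "Delta f s q v \<noteq> 0"
    and dir: "\<kappa> \<noteq> 0" "\<And>h. ext_deriv h v = \<kappa> * deriv (\<lambda>t. h (v + t *s e)) 0"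
    and mem: "\<And>t. v + t *s e \<noteq> 0 \<Longrightarrow> \<sigma> t \<in> f (line_through (v + t *s e))"
    and deriv: "\<And>p. ((\<lambda>t. \<sigma> t $ p) has_field_derivative \<sigma>' $ p) (at 0)"
    and \<sigma>': "\<sigma>' \<in> f (line_through v)"
  shows "\<sigma> 0 = 0"
proof -
  let ?E = "f (line_through v)"
  have v: "v \<noteq> 0" using U(2) by (rule punctured_cone_nonzero)
  have E: "vec.subspace ?E" by (rule fibre_subspace[OF f v])
  have s_reg: "(\<lambda>u. s j u $ p) \<in> twisting_sheaf 0 U" for j p
    using s unfolding frame_S_def subbundle_sheaf_def twist_sum_def by blast
  have s_mem: "s j u \<in> f (line_through u)" if "u \<in> punctured_cone U" for j u
    using s that by (simp add: frame_S_def subbundle_sheaf_def)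
  have "\<sigma> 0 \<in> ?E" using mem[of 0] v by simp
  then obtain c where c: "\<sigma> 0 = (\<Sum>j\<in>UNIV. c $ j *s s j v)"
    using s U(2) unfolding frame_S_def by blast
  define D where "D = (\<lambda>j. \<chi> p. deriv (\<lambda>t. s j (v + t *s e) $ p) 0)"
  have D: "((\<lambda>t. s j (v + t *s e) $ p) has_field_derivative D j $ p) (at 0)" for j p
    using twisting_sheaf_differentiable[OF s_reg, of v 0 e] U(2)
    by (simp add: D_def DERIV_deriv_iff_field_differentiable)
  have "\<sigma>' - (\<Sum>j\<in>UNIV. c $ j *s D j) \<in> ?E"
  proof (rule derivative_in_fibre[OF f v])
    show "\<sigma> 0 - (\<Sum>j\<in>UNIV. c $ j *s s j (v + 0 *s e)) = 0" by (simp add: c)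
    show "((\<lambda>t. (\<sigma> t - (\<Sum>j\<in>UNIV. c $ j *s s j (v + t *s e))) $ p) has_field_derivative
        (\<sigma>' - (\<Sum>j\<in>UNIV. c $ j *s D j)) $ p) (at 0)" for p
      unfolding vector_minus_component sum_component vector_smult_component
      by (intro DERIV_diff DERIV_sum DERIV_cmult deriv D)
    have "\<forall>\<^sub>F t in at 0. v + t *s e \<in> punctured_cone U"
      using eventually_compose_filterlim[OF eventually_punctured_cone[OF U] tendsto_line] .
    then show "\<forall>\<^sub>F t in at 0. \<sigma> t - (\<Sum>j\<in>UNIV. c $ j *s s j (v + t *s e)) \<in> f (line_through (v + t *s e))"
    proof eventually_elim
      case (elim t)
      have nz: "v + t *s e \<noteq> 0" using elim by (rule punctured_cone_nonzero)
      show ?case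
        by (intro vec.subspace_diff vec.subspace_sum vec.subspace_scale fibre_subspace[OF f nz] mem[OF nz] s_mem[OF elim])
    qed
  qed
  from vec.subspace_diff[OF E \<sigma>' this]
  have cD: "(\<Sum>j\<in>UNIV. c $ j *s D j) \<in> ?E" by simp
  define A where "A = (THE A :: complex^'d^'d. \<forall>j. differential f (s j) v =
            quotient_class ?E (\<Sum>i\<in>UNIV. A $ i $ j *s q i v))"
  have q_ex1: "\<exists>!c::complex^'d. quotient_class ?E u = quotient_class ?E (\<Sum>i\<in>UNIV. c $ i *s q i v)" for u
    using q U(2) unfolding frame_Q_def by blast
  have q_unique: "b = b'" if "quotient_class ?E u = quotient_class ?E (\<Sum>i\<in>UNIV. b $ i *s q i v)"
    "quotient_class ?E u = quotient_class ?E (\<Sum>i\<in>UNIV. b' $ i *s q i v)" for u b b'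
  proof (rule ex1E[OF q_ex1[of u]])
    fix z assume z: "\<forall>y. quotient_class ?E u = quotient_class ?E (\<Sum>i\<in>UNIV. y $ i *s q i v) \<longrightarrow> y = z"
    show ?thesis using z[rule_format, OF that(1)] z[rule_format, OF that(2)] by simp
  qed
  have differential: "differential f (s j) v = quotient_class ?E (\<kappa> *s D j)" for j
  proof -
    have "(\<chi> p. ext_deriv (\<lambda>u. s j u $ p) v) = \<kappa> *s D j"
      by (simp add: vec_eq_iff dir(2) D_def)
    then show ?thesis by (simp add: differential_def)
  qed
  have A: "differential f (s j) v = quotient_class ?E (\<Sum>i\<in>UNIV. A $ i $ j *s q i v)" for j
  proof -
    have "\<forall>j. \<exists>c :: complex^'d. differential f (s j) v = quotient_class ?E (\<Sum>i\<in>UNIV. c $ i *s q i v)"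
      unfolding differential by (intro allI ex1_implies_ex q_ex1)
    from choice[OF this] obtain C :: "'d \<Rightarrow> complex^'d" where
      C: "\<And>j. differential f (s j) v = quotient_class ?E (\<Sum>i\<in>UNIV. C j $ i *s q i v)"
      by blast
    have "\<exists>!A :: complex^'d^'d. \<forall>j. differential f (s j) v = quotient_class ?E (\<Sum>i\<in>UNIV. A $ i $ j *s q i v)"
    proof (rule ex1I[of _ "\<chi> i j. C j $ i"])
      show "\<forall>j. differential f (s j) v = quotient_class ?E (\<Sum>i\<in>UNIV. (\<chi> i j. C j $ i) $ i $ j *s q i v)"
        using C by simp
    next
      fix B :: "complex^'d^'d"
      assume B: "\<forall>j. differential f (s j) v = quotient_class ?E (\<Sum>i\<in>UNIV. B $ i $ j *s q i v)"
      have "(\<chi> i. B $ i $ j) = C j" for j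
      proof (rule q_unique)
        show "quotient_class ?E (\<kappa> *s D j) = quotient_class ?E (\<Sum>i\<in>UNIV. (\<chi> i. B $ i $ j) $ i *s q i v)"
          using B differential[of j] by simp
        show "quotient_class ?E (\<kappa> *s D j) = quotient_class ?E (\<Sum>i\<in>UNIV. C j $ i *s q i v)"
          using C[of j] differential[of j] by simp
      qed
      then show "B = (\<chi> i j. C j $ i)" by (auto simp: vec_eq_iff)
    qed
    from theI'[OF this] show ?thesis unfolding A_def by blast
  qed
  have diff: "\<kappa> *s D j - (\<Sum>i\<in>UNIV. A $ i $ j *s q i v) \<in> ?E" for j
  proof -
    have "quotient_class ?E (\<kappa> *s D j) = quotient_class ?E (\<Sum>i\<in>UNIV. A $ i $ j *s q i v)"
      using A[of j] differential[of j] by simp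
    then show ?thesis unfolding quotient_class_eq_iff[OF E] .
  qed
  have "(\<Sum>j\<in>UNIV. c $ j *s (\<kappa> *s D j - (\<Sum>i\<in>UNIV. A $ i $ j *s q i v))) \<in> ?E"
    by (intro vec.subspace_sum[OF E] vec.subspace_scale[OF E] diff)
  also have "(\<Sum>j\<in>UNIV. c $ j *s (\<kappa> *s D j - (\<Sum>i\<in>UNIV. A $ i $ j *s q i v))) =
      \<kappa> *s (\<Sum>j\<in>UNIV. c $ j *s D j) - (\<Sum>i\<in>UNIV. (A *v c) $ i *s q i v)"
  proof -
    have "(\<Sum>j\<in>UNIV. c $ j *s (\<Sum>i\<in>UNIV. A $ i $ j *s q i v)) = (\<Sum>i\<in>UNIV. (A *v c) $ i *s q i v)"
      unfolding vec.scale_sum_right matrix_vector_mult_def vec_lambda_beta vec.scale_sum_left vec.scale_scale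
      by (subst sum.swap) (simp add: mult.commute)
    moreover have "(\<Sum>j\<in>UNIV. c $ j *s (\<kappa> *s D j)) = \<kappa> *s (\<Sum>j\<in>UNIV. c $ j *s D j)"
      by (simp add: vec.scale_sum_right vec.scale_scale mult.commute)
    ultimately show ?thesis
      by (simp only: vec.scale_right_diff_distrib sum_subtractf)
  qed
  finally have "\<kappa> *s (\<Sum>j\<in>UNIV. c $ j *s D j) - (\<Sum>i\<in>UNIV. (A *v c) $ i *s q i v) \<in> ?E" .
  from vec.subspace_diff[OF E vec.subspace_scale[OF E cD, of \<kappa>] this]
  have "(\<Sum>i\<in>UNIV. (A *v c) $ i *s q i v) \<in> ?E" by simp
  then have "quotient_class ?E 0 = quotient_class ?E (\<Sum>i\<in>UNIV. (A *v c) $ i *s q i v)"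
    using vec.subspace_neg[OF E] by (simp add: quotient_class_eq_iff[OF E])
  moreover have "quotient_class ?E 0 = quotient_class ?E (\<Sum>i\<in>UNIV. (0 :: complex^'d) $ i *s q i v)"
    by simp
  ultimately have "A *v c = 0" by (rule q_unique)
  moreover have "invertible A"
    using Delta by (simp add: invertible_det_nz Delta_def A_def)
  ultimately have "c = 0"
    by (metis invertible_left_inverse matrix_left_invertible_ker)
  then show ?thesis by (simp add: c)
qed


section \<open>Linear frames\<close>

text \<open>
  The maximal minors of the frame are the Pluecker coordinates of \<open>f\<close>: forms of degree the sum of
  the \<open>a_j\<close> that have no common zero and generate \<open>f\<^sup>*det S\<close>.
\<close>

lemma curve_degree_frame:
  fixes f :: "'d::finite curve"
  assumes f: "is_morphism f" and S: "form_frame f a S" "\<And>v. v \<noteq> 0 \<Longrightarrow> inj ((*v) (S v))"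
  shows "curve_degree f = int (\<Sum>j\<in>UNIV. a j)"
proof -
  define p where "p = (\<lambda>v. wedge (\<lambda>j. column j (S v)) :: complex^('d \<Rightarrow> 'd \<times> 2))"
  have p_minor: "p v $ I = det (\<chi> i j. S v $ I i $ j)" for v I
    by (simp add: p_def wedge_def column_def)
  have S_form: "binary_form (a j) (\<lambda>v. S v $ q $ j)" for q j
    using S(1) unfolding form_frame_def by blast
  interpret generated_line_bundle "\<lambda>l. top_exterior_power (f l)" "\<Sum>j\<in>UNIV. a j" p
  proof
    fix I
    show "binary_form (\<Sum>j\<in>UNIV. a j) (\<lambda>v. p v $ I)"
      unfolding p_minor det_def vec_lambda_beta
    proof (intro binary_form_sum binary_form_cmult)
      fix \<pi> assume "\<pi> \<in> {\<pi>. \<pi> permutes (UNIV :: 'd set)}"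
      then have "(\<Sum>i\<in>UNIV. a (\<pi> i)) = (\<Sum>j\<in>UNIV. a j)"
        using sum.permute[of \<pi> UNIV a] by (simp add: o_def)
      then show "binary_form (\<Sum>j\<in>UNIV. a j) (\<lambda>v. \<Prod>i\<in>UNIV. S v $ I i $ \<pi> i)"
        using binary_form_prod[of UNIV "\<lambda>i. a (\<pi> i)" "\<lambda>i v. S v $ I i $ \<pi> i"] S_form
        by simp
    qed
  next
    fix v :: "complex^2" assume v: "v \<noteq> 0"
    obtain I where I: "det (\<chi> i j. S v $ I i $ j) \<noteq> 0" and fv: "f (line_through v) = range ((*v) (S v))"
      by (rule form_frame_minor[OF f S(1) v S(2)[OF v]])
    show "p v \<noteq> 0" using I p_minor[of v I] by auto
    have "wedge w \<in> vec.span {p v}" if w: "\<forall>j. w j \<in> f (line_through v)" for w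
    proof -
      obtain c where c: "\<And>j. w j = S v *v c j" using w unfolding fv image_iff by metis
      have "wedge w $ J = det (\<chi> i j. c j $ i) * p v $ J" for J
      proof -
        have "(\<chi> i j. w j $ J i) = (\<chi> i j. S v $ J i $ j) ** (\<chi> i j. c j $ i)"
          by (simp add: vec_eq_iff c matrix_vector_mult_def matrix_matrix_mult_def)
        then show ?thesis by (simp add: wedge_def p_minor det_mul)
      qed
      then have "wedge w = det (\<chi> i j. c j $ i) *s p v" by (simp add: vec_eq_iff)
      then show ?thesis by (auto simp: vec.span_singleton)
    qed
    moreover have "p v \<in> {wedge w | w. \<forall>j. w j \<in> f (line_through v)}"
    proof -
      have "column j (S v) \<in> f (line_through v)" for j
        using matrix_vector_mult_axis[of "S v" j] unfolding fv by (metis rangeI)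
      then show ?thesis unfolding p_def by blast
    qed
    ultimately show "top_exterior_power (f (line_through v)) = vec.span {p v}"
      unfolding top_exterior_power_def vec.span_eq
      by (auto intro: vec.span_base)
  qed
  show ?thesis by (simp add: curve_degree_def line_bundle_degree_eq)
qed

lemma binary_form_1_linear:
  assumes "binary_form 1 P"
  shows "P (x *s u + y *s w) = x * P u + y * P w"
proof -
  obtain c where "P = (\<lambda>v. \<Sum>k\<le>1. c k * (v$1)^k * (v$2)^(1 - k))"
    using assms by (rule binary_formE)
  then show ?thesis by (simp add: algebra_simps)
qed

text \<open>
  A frame of linear forms is linear in the point \<open>w\<close> and in the coefficients \<open>x\<close>, hence linear on
  the tensor product.
\<close>

lemma frame_matrix_tensor:
  fixes S :: "complex^2 \<Rightarrow> complex^'d^('d::finite \<times> 2)"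
  assumes "\<And>p j. binary_form 1 (\<lambda>v. S v $ p $ j)"
  shows "(\<chi> p q. S (axis (snd q) 1) $ p $ fst q) *v tensor x w = S w *v x"
proof -
  have "w = w$1 *s axis 1 1 + w$2 *s axis 2 1"
    by (simp add: vec_eq_iff forall_2 axis_def)
  then have w: "S w $ p $ j = w$1 * S (axis 1 1) $ p $ j + w$2 * S (axis 2 1) $ p $ j" for p j
    using binary_form_1_linear[OF assms] by metis
  have "(\<Sum>q\<in>UNIV. S (axis (snd q) 1) $ p $ fst q * (x $ fst q * w $ snd q)) = (\<Sum>j\<in>UNIV. S w $ p $ j * x $ j)" for p
  proof -
    have "(\<Sum>q\<in>UNIV. S (axis (snd q) 1) $ p $ fst q * (x $ fst q * w $ snd q))
        = (\<Sum>j\<in>UNIV. \<Sum>k\<in>UNIV. S (axis k 1) $ p $ j * (x $ j * w $ k))"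
      by (simp add: sum.cartesian_product case_prod_beta)
    also have "\<dots> = (\<Sum>j\<in>UNIV. S w $ p $ j * x $ j)"
      by (simp add: sum_2 w algebra_simps)
    finally show ?thesis .
  qed
  then show ?thesis by (simp add: vec_eq_iff matrix_vector_mult_def tensor_def)
qed

lemma tensor_decomposition:
  fixes u :: "complex^('d::finite \<times> 2)" and v e :: "complex^2"
  assumes "v$1 * e$2 - v$2 * e$1 \<noteq> 0"
  obtains x y where "u = tensor x v + tensor y e"
proof -
  obtain D where D: "v$1 * e$2 - v$2 * e$1 = D" "D \<noteq> 0" using assms by blast
  have "\<exists>x y. \<forall>k. u $ (i, k) = x * v $ k + y * e $ k" for i
  proof -
    define w :: "complex^2" where "w = (\<chi> k. u $ (i, k))"
    obtain x y where xy: "x *s v + y *s e = w"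
      using complex2_coordinates[OF D] by blast
    have "u $ (i, k) = x * v $ k + y * e $ k" for k
      using arg_cong[OF xy, of "\<lambda>z. z $ k"] by (simp add: w_def)
    then show ?thesis by blast
  qed
  then obtain x y where "\<And>i k. u $ (i, k) = x i * v $ k + y i * e $ k" by metis
  then have "u = tensor (\<chi> i. x i) v + tensor (\<chi> i. y i) e"
    by (simp add: vec_eq_iff tensor_def)
  then show thesis by (rule that)
qed

lemma morita_curve_line:
  "(morita_curve :: 'd::finite curve) (line_through v) = range (\<lambda>x. tensor x v)"
proof -
  let ?A = "{tensor x w | (x :: complex^'d) w. w \<in> line_through v}"
  let ?R = "range (\<lambda>x :: complex^'d. tensor x v)"
  have "?A = ?R"
  proof
    have scale: "tensor x (c *s v) = tensor (c *s x) v" for x :: "complex^'d" and c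
      by (simp add: tensor_def vec_eq_iff mult_ac)
    show "?A \<subseteq> ?R"
    proof
      fix z :: "complex^('d \<times> 2)"
      assume "z \<in> ?A"
      then obtain x c where "z = tensor x (c *s v)" unfolding mem_line_through by blast
      then show "z \<in> ?R" by (simp add: scale)
    qed
    show "?R \<subseteq> ?A"
      using vec.span_base[of v "{v}"] by blast
  qed
  moreover have "vec.subspace ?R"
  proof (rule vec.subspaceI)
    have "(0 :: complex^('d \<times> 2)) = tensor 0 v" by (simp add: tensor_def vec_eq_iff)
    then show "(0 :: complex^('d \<times> 2)) \<in> ?R" by blast
    have "tensor x v + tensor y v = tensor (x + y) v" for x y :: "complex^'d"
      by (simp add: tensor_def vec_eq_iff algebra_simps)
    then show "a + b \<in> ?R"
      if "a \<in> ?R" "b \<in> ?R" for a b :: "complex^('d \<times> 2)"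
      using that by auto
    have "c *s tensor x v = tensor (c *s x) v" for x :: "complex^'d" and c
      by (simp add: tensor_def vec_eq_iff mult_ac)
    then show "c *s a \<in> ?R"
      if "a \<in> ?R" for a :: "complex^('d \<times> 2)" and c
      using that by auto
  qed
  ultimately show ?thesis by (simp add: morita_curve_def vec.span_eq_iff)
qed

theorem mainTheorem1:
  fixes f :: "'d::finite curve"
  assumes "is_morphism f"
    and "curve_degree f = int CARD('d)"
    and "\<not> Delta_is_zero f"
    and "width f \<le> 3"
  shows "\<exists>g :: complex^('d \<times> 2)^('d \<times> 2).
           invertible g \<and> (\<forall>l\<in>P1. f l = (\<lambda>x. g *v x) ` morita_curve l)"
proof -
  note f = assms(1)
  obtain a S where S: "form_frame f a S" "\<And>v. v \<noteq> 0 \<Longrightarrow> inj ((*v) (S v))"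
    using splitting_frame_exists[OF f] by metis
  have S_form: "binary_form (a j) (\<lambda>v. S v $ p $ j)" for p j
    using S(1) unfolding form_frame_def by blast
  have S_mem: "S v *v c \<in> f (line_through v)" if "v \<noteq> 0" for v c
    using S(1) that by (simp add: form_frame_def)
  have S_inj: "S v *v c = 0 \<Longrightarrow> c = 0" if "v \<noteq> 0" for v c
    using S(2)[OF that] by (simp add: inj_matrix_iff)
  obtain U s q v where U: "zariski_open U" "frame_S f U s" "frame_Q f U q" "v \<in> punctured_cone U"
    and Delta: "Delta f s q v \<noteq> 0"
    using assms(3) unfolding Delta_is_zero_def by blast
  have v: "v \<noteq> 0" using U(4) by (rule punctured_cone_nonzero)
  obtain e \<kappa> where e: "v$1 * e$2 - v$2 * e$1 \<noteq> 0" "\<kappa> \<noteq> 0"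
    "\<And>h. ext_deriv h v = \<kappa> * deriv (\<lambda>t. h (v + t *s e)) 0"
    using ext_deriv_direction[OF v] by metis
  note injective = Delta_nonzero_injective[OF f U(1,4,2,3) Delta e(2,3)]
  \<comment> \<open>a column of degree 0 is a constant section, which the differential would kill\<close>
  have a_pos: "a j \<noteq> 0" for j
  proof
    assume "a j = 0"
    then have const: "column j (S u) = column j (S v)" for u
      using S_form[of j] binary_form_degree_0 by (simp add: column_def vec_eq_iff) blast
    have col: "column j (S u) = S u *v axis j 1" for u
      by (rule matrix_vector_mult_axis[symmetric])
    have "column j (S v) = 0"
    proof (rule injective[of "\<lambda>_. column j (S v)" 0])
      show "column j (S v) \<in> f (line_through (v + t *s e))" if "v + t *s e \<noteq> 0" for t
        using S_mem[OF that] col const by metis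
      show "0 \<in> f (line_through v)" by (rule vec.subspace_0[OF fibre_subspace[OF f v]])
    qed simp
    then have "axis j (1 :: complex) = 0" unfolding col by (rule S_inj[OF v])
    then show False by simp
  qed
  have a: "a j = 1" for j
  proof -
    have "(\<Sum>j\<in>UNIV. a j) = CARD('d)"
    proof -
      have "curve_degree f = int (\<Sum>j\<in>UNIV. a j)"
        by (rule curve_degree_frame[OF f S(1)]) (rule S(2))
      then show ?thesis using assms(2) by (simp only: of_nat_eq_iff)
    qed
    also have "\<dots> = (\<Sum>j\<in>(UNIV :: 'd set). 1)" by simp
    finally have "(\<Sum>j\<in>UNIV. a j) = (\<Sum>j\<in>(UNIV :: 'd set). 1)" .
    moreover have "1 \<le> a j" for j using a_pos[of j] by simp
    ultimately show ?thesis
      using sum_mono_inv[of "\<lambda>_. 1" UNIV a j] by simp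
  qed
  define g :: "complex^('d \<times> 2)^('d \<times> 2)" where "g = (\<chi> p q. S (axis (snd q) 1) $ p $ fst q)"
  have linear: "binary_form 1 (\<lambda>v. S v $ p $ j)" for p j
    using S_form[of j] a by simp
  have g: "g *v tensor x w = S w *v x" for x w
    unfolding g_def by (rule frame_matrix_tensor[OF linear])
  have "u = 0" if gu: "g *v u = 0" for u
  proof -
    obtain x y where u: "u = tensor x v + tensor y e"
      using tensor_decomposition[OF e(1)] by metis
    have xy: "S v *v x + S e *v y = 0"
      using gu by (simp add: u matrix_vector_right_distrib g)
    \<comment> \<open>the section \<open>S(u) y\<close> has derivative \<open>S(e) y = - S(v) x\<close> at \<open>v\<close>, which lies in the fibre\<close>
    have S_line: "S (v + t *s e) *v y = S v *v y + t *s (S e *v y)" for t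
      using binary_form_1_linear[OF linear, of 1 v t e]
      by (simp add: vec_eq_iff matrix_vector_mult_def algebra_simps sum.distrib sum_distrib_left)
    have "S (v + 0 *s e) *v y = 0"
    proof (rule injective[of "\<lambda>t. S (v + t *s e) *v y" "S e *v y"])
      show "S (v + t *s e) *v y \<in> f (line_through (v + t *s e))" if "v + t *s e \<noteq> 0" for t
        by (rule S_mem[OF that])
      show "((\<lambda>t. (S (v + t *s e) *v y) $ p) has_field_derivative (S e *v y) $ p) (at 0)" for p
        unfolding S_line vector_add_component vector_smult_component
        by (auto intro!: derivative_eq_intros)
      have "S e *v y = - (S v *v x)" using xy by (simp add: eq_neg_iff_add_eq_0 add.commute)
      then show "S e *v y \<in> f (line_through v)"
        using vec.subspace_neg[OF fibre_subspace[OF f v] S_mem[OF v]] by simp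
    qed
    then have "y = 0" using S_inj[OF v] by simp
    moreover from this have "x = 0" using xy S_inj[OF v] by simp
    ultimately show "u = 0" by (simp add: u tensor_def vec_eq_iff)
  qed
  then have "invertible g"
    unfolding invertible_left_inverse matrix_left_invertible_ker by blast
  moreover have "f l = (\<lambda>x. g *v x) ` morita_curve l" if "l \<in> P1" for l
  proof -
    obtain w where w: "w \<noteq> 0" "l = line_through w" using \<open>l \<in> P1\<close> by (rule P1_cases)
    have "f l = range ((*v) (S w))"
      unfolding w(2) by (rule form_frame_minor[OF f S(1) w(1) S(2)[OF w(1)]])
    also have "\<dots> = (\<lambda>x. g *v x) ` range (\<lambda>x. tensor x w)"
      by (simp add: image_image g)
    finally show ?thesis by (simp add: w(2) morita_curve_line)
  qed
  ultimately show ?thesis by blast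
qed

end
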